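(* Let $\mathcal{H}\subset\mathbb{R}^n$ be a finite set of mutually non-parallel non-zero vectors, and let $$L=-\Delta+R(x),\qquad R(x)=\sum_{\alpha\in\mathcal{H}}\frac{C_\alpha}{\langle\alpha,x\rangle^2}+\widetilde R(x),$$ where $C_\alpha\neq 0$ for every $\alpha\in\mathcal{H}$ and $\widetilde R$ is real analytic at $x=0$. Let $P$ be a linear differential operator whose principal symbol is constant in $x$ and which commutes with $L$, i.e. $[L,P]=0$. Let $\alpha\in\mathcal{H}$. If $C_\alpha\neq k(k+1)\langle\alpha,\alpha\rangle$ for every integer $k$, then the principal symbol of $P$ is $r_\alpha$-invariant.
   Context: $\langle\cdot,\cdot\rangle$ is the standard inner product on $\mathbb{R}^n$ and $\Delta=\sum_{i=1}^n\partial^2/\partial x_i^2$. For a non-zero vector $\alpha$, $H_\alpha=\{x:\langle\alpha,x\rangle=0\}$ and $r_\alpha$ is the orthogonal reflection with respect to $H_\alpha$. Constants and functions may be complex-valued. Let $U$ be an open ball centred at $0$ on which $\widetilde R$ is real analytic; $L$ is considered on $D=U\setminus\bigcup_{\beta\in\mathcal{H}}H_\beta$, and $P$ is a differential operator on $D$ with real analytic coefficients. Writing $P=\sum_{|p|\le m_0}a_p(x)\partial^p$ (multi-indices $p$) with order $m_0$, its principal symbol is the polynomial $\widetilde P_0=\sum_{|p|=m_0}a_p(x)\xi^p$ in $\xi=(\xi_1,\dots,\xi_n)$; "constant" means that the $a_p$ with $|p|=m_0$ are constants on $D$. $r_\alpha$-invariance means $\widetilde P_0(r_\alpha\xi)=\widetilde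 P_0(\xi)$. *)

theory Defs
  imports "HOL-Analysis.Analysis"
begin

text \<open>A multi-index is a function \<open>p :: 'n \<Rightarrow> nat\<close> on the finite index type of \<open>real ^ 'n\<close>.\<close>

definition mi_size :: "('n::finite \<Rightarrow> nat) \<Rightarrow> nat" where
  "mi_size p = (\<Sum>i\<in>UNIV. p i)"

lemma finite_mi_size_le: "finite {p :: 'n::finite \<Rightarrow> nat. mi_size p \<le> m}"
proof (rule finite_subset)
  show "{p :: 'n \<Rightarrow> nat. mi_size p \<le> m} \<subseteq> PiE UNIV (\<lambda>_. {..m})"
    by (auto simp: mi_size_def intro: order_trans[OF member_le_sum[where A = UNIV]])
qed (auto intro: finite_PiE)

definition mi_power :: "real ^ 'n \<Rightarrow> ('n \<Rightarrow> nat) \<Rightarrow> real" where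
  "mi_power x p = (\<Prod>i\<in>UNIV. (x $ i) ^ p i)"

definition real_analytic_at :: "(real ^ 'n \<Rightarrow> complex) \<Rightarrow> real ^ 'n \<Rightarrow> bool" where
  "real_analytic_at f z \<longleftrightarrow> (\<exists>c :: ('n \<Rightarrow> nat) \<Rightarrow> complex. \<exists>\<rho>>0. \<forall>x\<in>ball z \<rho>.
     ((\<lambda>p. c p * of_real (mi_power (x - z) p)) has_sum f x) UNIV)"

definition real_analytic_on :: "(real ^ 'n \<Rightarrow> complex) \<Rightarrow> (real ^ 'n) set \<Rightarrow> bool" where
  "real_analytic_on f S \<longleftrightarrow> (\<forall>z\<in>S. real_analytic_at f z)"

definition pderiv_at :: "'n \<Rightarrow> (real ^ 'n \<Rightarrow> complex) \<Rightarrow> real ^ 'n \<Rightarrow> complex" where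
  "pderiv_at i f x = vector_derivative (\<lambda>t. f (x + t *\<^sub>R axis i 1)) (at 0)"

text \<open>The index type carries no order, so the one-variable derivatives making up \<open>\<partial>\<^sup>p\<close> are
  composed along an arbitrary fixed enumeration of it. Operators are only ever applied to smooth
  functions, where partial derivatives commute and the choice is immaterial.\<close>

definition index_list :: "'n::finite list" where
  "index_list = (SOME xs. distinct xs \<and> set xs = UNIV)"

lemma index_list: "distinct (index_list :: 'n::finite list)" "set (index_list :: 'n list) = UNIV"
proof -
  have "\<exists>xs :: 'n list. distinct xs \<and> set xs = UNIV"
    using finite_distinct_list[of "UNIV :: 'n set"] by auto
  then have "distinct (index_list :: 'n list) \<and> set (index_list :: 'n list) = UNIV"
    unfolding index_list_def by (rule someI_ex)
  then show "distinct (index_list :: 'n list)" "set (index_list :: 'n list) = UNIV" by auto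
qed

definition mi_deriv :: "('n \<Rightarrow> nat) \<Rightarrow> (real ^ 'n \<Rightarrow> complex) \<Rightarrow> real ^ 'n \<Rightarrow> complex" where
  "mi_deriv p f = foldr (\<lambda>i. pderiv_at i ^^ p i) index_list f"

text \<open>\<open>C\<^sup>\<infinity>\<close> on an open set \<open>S\<close>: all iterated partial derivatives, taken in any order, are
  (Frechet) differentiable, hence in particular continuous and partially differentiable, on \<open>S\<close>.\<close>

definition smooth_on :: "(real ^ 'n \<Rightarrow> complex) \<Rightarrow> (real ^ 'n) set \<Rightarrow> bool" where
  "smooth_on f S \<longleftrightarrow> (\<forall>js. (foldr pderiv_at js f) differentiable_on S)"

definition laplacian :: "(real ^ 'n \<Rightarrow> complex) \<Rightarrow> real ^ 'n \<Rightarrow> complex" where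
  "laplacian f x = (\<Sum>i\<in>UNIV. pderiv_at i (pderiv_at i f) x)"

definition schroedinger :: "(real ^ 'n \<Rightarrow> complex) \<Rightarrow> (real ^ 'n \<Rightarrow> complex) \<Rightarrow> real ^ 'n \<Rightarrow> complex" where
  "schroedinger R f x = - laplacian f x + R x * f x"

definition potential ::
  "(real ^ 'n) set \<Rightarrow> (real ^ 'n \<Rightarrow> complex) \<Rightarrow> (real ^ 'n \<Rightarrow> complex) \<Rightarrow> real ^ 'n \<Rightarrow> complex" where
  "potential H C R' x = (\<Sum>\<alpha>\<in>H. C \<alpha> / of_real ((\<alpha> \<bullet> x)\<^sup>2)) + R' x"

definition hyperplane :: "real ^ 'n \<Rightarrow> (real ^ 'n) set" where
  "hyperplane \<alpha> = {x. \<alpha> \<bullet> x = 0}"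

definition reflection :: "real ^ 'n \<Rightarrow> real ^ 'n \<Rightarrow> real ^ 'n" where
  "reflection \<alpha> x = x - (2 * (\<alpha> \<bullet> x) / (\<alpha> \<bullet> \<alpha>)) *\<^sub>R \<alpha>"

text \<open>A differential operator \<open>\<Sum>\<^bsub>|p| \<le> m\<^esub> a\<^sub>p(x) \<partial>\<^sup>p\<close> is given by \<open>m\<close> and its coefficients \<open>a\<close>;
  values \<open>a p\<close> with \<open>|p| > m\<close> are ignored.\<close>

definition diff_op ::
  "nat \<Rightarrow> (('n \<Rightarrow> nat) \<Rightarrow> real ^ 'n \<Rightarrow> complex) \<Rightarrow> (real ^ 'n \<Rightarrow> complex) \<Rightarrow> real ^ 'n \<Rightarrow> complex" where
  "diff_op m a f x = (\<Sum>p | mi_size p \<le> m. a p x * mi_deriv p f x)"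

definition analytic_coeffs_on ::
  "(real ^ 'n) set \<Rightarrow> nat \<Rightarrow> (('n \<Rightarrow> nat) \<Rightarrow> real ^ 'n \<Rightarrow> complex) \<Rightarrow> bool" where
  "analytic_coeffs_on D m a \<longleftrightarrow> (\<forall>p. mi_size p \<le> m \<longrightarrow> real_analytic_on (a p) D)"

definition has_order_on ::
  "(real ^ 'n) set \<Rightarrow> nat \<Rightarrow> (('n \<Rightarrow> nat) \<Rightarrow> real ^ 'n \<Rightarrow> complex) \<Rightarrow> bool" where
  "has_order_on D m a \<longleftrightarrow> (\<exists>p. mi_size p = m \<and> (\<exists>x\<in>D. a p x \<noteq> 0))"

definition principal_symbol ::
  "nat \<Rightarrow> (('n \<Rightarrow> nat) \<Rightarrow> real ^ 'n \<Rightarrow> complex) \<Rightarrow> real ^ 'n \<Rightarrow> real ^ 'n \<Rightarrow> complex" where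
  "principal_symbol m a x \<xi> = (\<Sum>p | mi_size p = m. a p x * of_real (mi_power \<xi> p))"

definition constant_principal_symbol_on ::
  "(real ^ 'n) set \<Rightarrow> nat \<Rightarrow> (('n \<Rightarrow> nat) \<Rightarrow> real ^ 'n \<Rightarrow> complex) \<Rightarrow> bool" where
  "constant_principal_symbol_on D m a \<longleftrightarrow> (\<forall>p. mi_size p = m \<longrightarrow> a p constant_on D)"

text \<open>\<open>[A, B] = 0\<close> as operators on \<open>C\<^sup>\<infinity>(D)\<close>; for differential operators this is the same as
  the vanishing of all coefficients of \<open>[A, B]\<close>.\<close>

definition commute_on ::
  "(real ^ 'n) set \<Rightarrow> ((real ^ 'n \<Rightarrow> complex) \<Rightarrow> real ^ 'n \<Rightarrow> complex) \<Rightarrow>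
   ((real ^ 'n \<Rightarrow> complex) \<Rightarrow> real ^ 'n \<Rightarrow> complex) \<Rightarrow> bool" where
  "commute_on D A B \<longleftrightarrow> (\<forall>f. smooth_on f D \<longrightarrow> (\<forall>x\<in>D. A (B f) x = B (A f) x))"

end

theory Submission
  imports Defs
begin

text \<open>
  Near a generic point of the wall \<open>u = \<alpha> \<bullet> x = 0\<close> the coefficients of \<open>P\<close> can be controlled from one side
  \<open>u > 0\<close>. Expanding \<open>[L, P] e\<^bsup>\<tau> \<xi> \<bullet> x\<^esup> = 0\<close> in powers of \<open>\<tau>\<close> gives transport equations for the
  homogeneous parts of the symbol of \<open>P\<close>; integrating them towards the wall shows inductively that
  a coefficient \<open>a\<^sub>q\<close> with \<open>|q| = m - j\<close> has the form \<open>c\<^sub>q u\<^bsup>-j\<^esup>\<close> up to terms of lower order, with \<open>c\<^sub>q\<close> a number.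
  Applying \<open>[L, P]\<close> to \<open>u\<^sup>s e\<^bsup>\<tau> \<eta> \<bullet> x\<^esup>\<close> with \<open>\<eta>\<close> orthogonal to \<open>\<alpha>\<close> and taking leading coefficients yields, with
  \<open>\<kappa> = C\<^sub>\<alpha> / \<langle>\<alpha>, \<alpha>\<rangle>\<close>, polynomials \<open>Q\<close> in \<open>s\<close> such that
  \<open>(\<kappa> - (s - l) (s - l - 1)) Q s = (\<kappa> - s (s - 1)) Q (s - 2)\<close>, whose coefficient of \<open>s\<^sup>l\<close> is the coefficient of
  \<open>\<sigma>\<^sup>l\<close> in the principal symbol at \<open>\<sigma> \<alpha> + \<eta>\<close>. For odd \<open>l\<close> and \<open>\<kappa> \<noteq> k (k + 1)\<close> a root \<open>s\<close> of
  \<open>\<kappa> = s (s - 1)\<close> propagates to all \<open>s + 2 j\<close>, hence \<open>Q = 0\<close> and the principal symbol is even in \<open>\<sigma>\<close>.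
\<close>

subsection \<open>Real analytic functions are smooth\<close>

text \<open>The coefficients of \<open>P\<close> are analytic only off the hyperplanes, so their
  behaviour at the wall is unknown at the outset. A constant principal symbol starts the induction:
  the right side of a transport equation has leading term \<open>c * u^(-j-1)\<close>, its integral
  is \<open>c' * u^(-j)\<close>, and the unknown constant of integration, which is bounded near the
  wall, is absorbed because \<open>j\<close> is at least 1. One number per coefficient is therefore
  enough. On \<open>u^s\<close> times an exponential along the wall, \<open>L\<close> acts to
  leading order through its indicial polynomial in \<open>s\<close>, and the part of
  \<open>P\<close> belonging to \<open>\<tau>^(m-l)\<close> sends \<open>u^s\<close> to
  \<open>Q(s) * u^(s-l)\<close>. Since \<eta> is tangential, the transport term has no leading part,
  so the powers of \<tau> decouple. Coefficients of order below \<open>m\<close> are too low in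
  degree to reach \<open>s^l\<close>, hence the numbers found for them do not enter the conclusion.
  Oddness of \<open>l\<close> and the condition on \<kappa> serve one purpose: if the left factor of
  the recursion vanished at \<open>s + 2j\<close> for a root \<open>s\<close>, then either
  \<open>l = 2j\<close>, or \<open>s\<close> is an integer and \<kappa> is of the form
  \<open>k * (k + 1)\<close>.\<close>

lemma mi_power_bound:
  fixes y :: "real ^ 'n"
  assumes "\<And>j. \<bar>y $ j\<bar> \<le> s"
  shows "\<bar>mi_power y p\<bar> \<le> s ^ mi_size p"
proof -
  have "\<bar>mi_power y p\<bar> = (\<Prod>i\<in>UNIV. \<bar>y $ i\<bar> ^ p i)"
    by (simp add: mi_power_def abs_prod power_abs)
  also have "\<dots> \<le> (\<Prod>i\<in>UNIV. s ^ p i)"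
    by (intro prod_mono) (auto intro!: power_mono assms)
  finally show ?thesis by (simp add: mi_size_def power_sum)
qed

lemma mi_power_const: "mi_power (\<chi> i. s) p = s ^ mi_size p"
  by (simp add: mi_power_def mi_size_def power_sum)

lemma mi_size_upd: "mi_size (p(i := k)) + p i = mi_size p + k"
  by (simp add: mi_size_def sum.remove[of UNIV i])

lemma mi_power_upd: "mi_power y (p(i := k)) = (y $ i) ^ k * (\<Prod>j\<in>UNIV-{i}. (y $ j) ^ p j)"
  by (simp add: mi_power_def prod.remove[of UNIV i])

lemma has_derivative_mi_power:
  fixes z :: "real ^ 'n"
  shows "((\<lambda>x. mi_power (x - z) p) has_derivative
     (\<lambda>h. \<Sum>i\<in>UNIV. h $ i * (real (p i) * mi_power (x - z) (p(i := p i - 1))))) (at x within S)"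
proof -
  have *: "((\<lambda>x. ((x - z) $ i) ^ p i) has_derivative
      (\<lambda>h. h $ i * (real (p i) * ((x - z) $ i) ^ (p i - 1)))) (at x within S)" for i
    by (rule has_derivative_eq_rhs)
       (auto intro!: derivative_eq_intros bounded_linear.has_derivative[OF bounded_linear_vec_nth])
  show ?thesis
    unfolding mi_power_def
    by (rule has_derivative_eq_rhs[OF has_derivative_prod[OF *]],
        unfold mi_power_def[symmetric])
       (simp only: mi_power_upd power_one_right mult.assoc fun_upd_same cong: sum.cong; simp add: mult_ac)
qed

text \<open>Differentiation brings down the factor \<open>p i\<close>, which is at most
  \<open>2 ^ mi_size p\<close>; shrinking the radius from \<open>s\<close> to \<open>s / 2\<close>
  pays for it, and \<open>2 / s\<close> replaces the lost power.\<close>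

lemma mi_power_deriv_bound:
  fixes y :: "real ^ 'n"
  assumes "\<And>j. \<bar>y $ j\<bar> \<le> s / 2" "s > 0"
  shows "\<bar>real (p i) * mi_power y (p(i := p i - 1))\<bar> \<le> 2 / s * s ^ mi_size p"
proof (cases "p i")
  case 0
  then show ?thesis using assms by simp
next
  case (Suc k)
  define N where "N = mi_size (p(i := k))"
  have N: "mi_size p = Suc N"
    using mi_size_upd[of p i k] Suc by (simp add: N_def)
  have "p i \<le> mi_size p"
    unfolding mi_size_def by (rule member_le_sum) auto
  then have "p i \<le> Suc N" by (simp add: N)
  also have "Suc N \<le> 2 ^ Suc N"
    using less_exp[of "Suc N"] by simp
  finally have pi: "real (p i) \<le> 2 * 2 ^ N"
    by (metis of_nat_le_iff of_nat_numeral of_nat_power power_Suc)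
  have "\<bar>real (p i) * mi_power y (p(i := p i - 1))\<bar> \<le> real (p i) * (s / 2) ^ N"
    using mi_power_bound[OF assms(1), of "p(i := k)"] Suc
    by (simp add: abs_mult N_def mult_left_mono)
  also have "\<dots> \<le> 2 * 2 ^ N * (s / 2) ^ N"
    using assms pi by (intro mult_right_mono) auto
  also have "\<dots> = 2 / s * s ^ mi_size p"
    using assms by (simp add: N power_divide field_simps)
  finally show ?thesis .
qed

lemma infinite_mi: "infinite (UNIV :: ('n::finite \<Rightarrow> nat) set)"
proof
  assume *: "finite (UNIV :: ('n \<Rightarrow> nat) set)"
  have "inj (\<lambda>k::nat. (\<lambda>_::'n. k))" by (auto simp: inj_def fun_eq_iff)
  then show False using * finite_imageD[of "\<lambda>k::nat. (\<lambda>_::'n. k)" UNIV]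
    by (meson finite_subset infinite_UNIV_nat subset_UNIV)
qed

text \<open>An enumeration of the multi-indices turns unconditional sums into ordinary series, to
  which termwise differentiation applies.\<close>

lemma bij_mi: "bij (from_nat_into (UNIV :: ('n::finite \<Rightarrow> nat) set))"
  using bij_betw_from_nat_into[OF _ infinite_mi] by auto

text \<open>On a smaller ball the differentiated terms have a summable majorant that does not depend
  on the point, so the series of derivatives converges uniformly there.\<close>

lemma power_series_pderiv:
  fixes f :: "real ^ 'n \<Rightarrow> complex"
  assumes "\<rho> > 0"
    and sum: "\<And>x. x \<in> ball z \<rho> \<Longrightarrow> ((\<lambda>p. c p * of_real (mi_power (x - z) p)) has_sum f x) UNIV"
  obtains \<rho>' where "\<rho>' > 0" "f differentiable_on ball z \<rho>'"
    "\<And>x i. x \<in> ball z \<rho>' \<Longrightarrow>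
      ((\<lambda>p. of_nat (p i + 1) * c (p(i := p i + 1)) * of_real (mi_power (x - z) p)) has_sum pderiv_at i f x) UNIV"
proof -
  \<comment> \<open>The corner \<open>z + (s, ..., s)\<close> is at distance at most
    \<open>CARD('n') * s = \<rho> / 2\<close> from \<open>z\<close>. Convergence at this one point
    makes \<open>norm (c p) * s ^ mi_size p\<close> summable.\<close>
  define s where "s = \<rho> / (2 * real CARD('n))"
  have s: "s > 0" using assms by (simp add: s_def)
  define y0 :: "real ^ 'n" where "y0 = z + (\<chi> i. s)"
  have "norm (y0 - z) \<le> (\<Sum>i\<in>UNIV. norm ((y0 - z) $ i))"
    by (rule norm_le_l1_cart[unfolded real_norm_def[symmetric]])
  also have "\<dots> = \<rho> / 2" using s by (simp add: y0_def) (simp add: s_def)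
  finally have "y0 \<in> ball z \<rho>" using assms by (simp add: dist_norm norm_minus_commute)
  from sum[OF this] have "(\<lambda>p. c p * of_real (s ^ mi_size p)) summable_on UNIV"
    by (auto simp: y0_def mi_power_const summable_on_def)
  then have abs: "(\<lambda>p. norm (c p) * s ^ mi_size p) summable_on UNIV"
    using s by (subst (asm) summable_on_iff_abs_summable_on_complex)
      (simp add: norm_mult norm_power)
  define \<rho>' where "\<rho>' = min \<rho> (s / 2)"
  have \<rho>': "\<rho>' > 0" "\<rho>' \<le> \<rho>" using s assms by (auto simp: \<rho>'_def)
  define e where "e = from_nat_into (UNIV :: ('n \<Rightarrow> nat) set)"
  have e: "bij e" unfolding e_def by (rule bij_mi)
  define d where "d i p x = c p * of_real (real (p i) * mi_power (x - z) (p(i := p i - 1)))" for i p x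
  define M where "M p = norm (c p) * (2 / s * s ^ mi_size p)" for p
  have M: "M summable_on UNIV"
    using summable_on_cmult_right[OF abs, of "2 / s"] by (simp add: M_def[abs_def] mult_ac)
  have dM: "norm (d i p x) \<le> M p" if "x \<in> ball z \<rho>'" for i p x
  proof -
    have "\<bar>(x - z) $ j\<bar> \<le> s / 2" for j
      using component_le_norm_cart[of "x - z" j] that by (simp add: \<rho>'_def dist_norm norm_minus_commute)
    then show ?thesis
      unfolding d_def M_def norm_mult using mi_power_deriv_bound[of "x - z" s p i] s
      by (intro mult_left_mono) (auto simp: norm_mult abs_mult)
  qed
  have dsum: "(\<lambda>p. d i p x) summable_on UNIV" if "x \<in> ball z \<rho>'" for i x
    by (rule summable_on_comparison_test[OF M, THEN abs_summable_summable])
       (use dM[OF that] in auto)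
  have Me: "summable (\<lambda>n. M (e n))"
    using M e by (simp add: summable_on_reindex_bij_betw[OF e, symmetric] summable_on_imp_summable)
  have desums: "(\<lambda>n. d i (e n) x) sums (infsum (\<lambda>p. d i p x) UNIV)" if "x \<in> ball z \<rho>'" for i x
    using has_sum_infsum[OF dsum[OF that, of i]] e
    by (simp add: has_sum_reindex_bij_betw[OF e, symmetric] has_sum_imp_sums)
  define g' where "g' x h = (\<Sum>i\<in>UNIV. of_real (h $ i) * infsum (\<lambda>p. d i p x) UNIV)" for x and h :: "real ^ 'n"
  have "\<exists>g. \<forall>x\<in>ball z \<rho>'. (\<lambda>n. c (e n) * of_real (mi_power (x - z) (e n))) sums (g x) \<and>
      (g has_derivative g' x) (at x within ball z \<rho>')"
  proof (rule has_derivative_series)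
    show "((\<lambda>x. c (e n) * of_real (mi_power (x - z) (e n))) has_derivative
       (\<lambda>h. \<Sum>i\<in>UNIV. of_real (h $ i) * d i (e n) x)) (at x within ball z \<rho>')" for n x
      by (rule has_derivative_eq_rhs, rule has_derivative_mult_right,
          rule bounded_linear.has_derivative[OF bounded_linear_of_real], rule has_derivative_mi_power)
         (auto simp: d_def sum_distrib_left intro!: ext sum.cong)
  next
    fix \<epsilon> :: real assume \<epsilon>: "\<epsilon> > 0"
    define N where "N = real CARD('n)"
    have N: "N > 0" by (simp add: N_def)
    have "(\<lambda>n. \<Sum>k. M (e (k + n))) \<longlonglongrightarrow> 0"
      using suminf_exist_split2[OF Me] by simp
    then have "eventually (\<lambda>n. (\<Sum>k. M (e (k + n))) < \<epsilon> / N) sequentially"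
      using \<epsilon> N by (intro order_tendstoD) auto
    then show "\<forall>\<^sub>F n in sequentially. \<forall>x\<in>ball z \<rho>'. \<forall>h.
       norm ((\<Sum>k<n. \<Sum>i\<in>UNIV. of_real (h $ i) * d i (e k) x) - g' x h) \<le> \<epsilon> * norm h"
    proof eventually_elim
      case (elim n)
      show ?case
      proof (intro ballI allI)
        fix x and h :: "real ^ 'n" assume x: "x \<in> ball z \<rho>'"
        have *: "norm ((\<Sum>k<n. d i (e k) x) - infsum (\<lambda>p. d i p x) UNIV) \<le> \<epsilon> / N" for i
        proof -
          have s1: "summable (\<lambda>k. norm (d i (e (k + n)) x))"
            by (rule summable_comparison_test[OF _ summable_ignore_initial_segment[OF Me, of n]])
               (use dM[OF x] in auto)
          have "infsum (\<lambda>p. d i p x) UNIV = (\<Sum>k. d i (e (k + n)) x) + (\<Sum>k<n. d i (e k) x)"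
            using desums[OF x, of i] suminf_split_initial_segment[of "\<lambda>k. d i (e k) x" n]
            by (auto simp: sums_iff)
          then have "norm ((\<Sum>k<n. d i (e k) x) - infsum (\<lambda>p. d i p x) UNIV) = norm (\<Sum>k. d i (e (k + n)) x)"
            by (simp add: norm_minus_commute)
          also have "\<dots> \<le> (\<Sum>k. norm (d i (e (k + n)) x))"
            by (rule summable_norm[OF s1])
          also have "\<dots> \<le> (\<Sum>k. M (e (k + n)))"
            by (rule suminf_le[OF _ s1 summable_ignore_initial_segment[OF Me]]) (use dM[OF x] in auto)
          finally show ?thesis using elim by simp
        qed
        have "(\<Sum>k<n. \<Sum>i\<in>UNIV. of_real (h $ i) * d i (e k) x) - g' x h
           = (\<Sum>i\<in>UNIV. of_real (h $ i) * ((\<Sum>k<n. d i (e k) x) - infsum (\<lambda>p. d i p x) UNIV))"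
          unfolding g'_def by (subst sum.swap) (simp add: sum_distrib_left sum_subtractf algebra_simps)
        also have "norm \<dots> \<le> (\<Sum>i\<in>(UNIV::'n set). norm h * (\<epsilon> / N))"
          by (rule sum_norm_le) (use component_le_norm_cart[of h] in \<open>auto simp: norm_mult simp del: times_divide_eq_right intro!: mult_mono *\<close>)
        also have "\<dots> = \<epsilon> * norm h" using N by (simp add: N_def)
        finally show "norm ((\<Sum>k<n. \<Sum>i\<in>UNIV. of_real (h $ i) * d i (e k) x) - g' x h) \<le> \<epsilon> * norm h" .
      qed
    qed
  next
    show "z \<in> ball z \<rho>'" using \<rho>' by simp
    show "(\<lambda>n. c (e n) * of_real (mi_power (z - z) (e n))) sums f z"
      using sum[of z] assms(1)
      by (simp add: has_sum_reindex_bij_betw[OF e, symmetric] has_sum_imp_sums)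
  qed simp
  then obtain g where g: "\<And>x. x \<in> ball z \<rho>' \<Longrightarrow> (\<lambda>n. c (e n) * of_real (mi_power (x - z) (e n))) sums (g x)"
    and g': "\<And>x. x \<in> ball z \<rho>' \<Longrightarrow> (g has_derivative g' x) (at x within ball z \<rho>')"
    by blast
  have fg: "f x = g x" if "x \<in> ball z \<rho>'" for x
  proof -
    have "(\<lambda>n. c (e n) * of_real (mi_power (x - z) (e n))) sums f x"
      using sum[of x] that \<rho>'
      by (simp add: has_sum_reindex_bij_betw[OF e, symmetric] has_sum_imp_sums)
    then show ?thesis using g[OF that] sums_unique2 by blast
  qed
  have f': "(f has_derivative g' x) (at x)" if "x \<in> ball z \<rho>'" for x
    using has_derivative_transform[OF that fg g'[OF that]] that
    by (simp add: at_within_open[OF _ open_ball])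
  show thesis
  proof
    show "\<rho>' > 0" by fact
    show "f differentiable_on ball z \<rho>'"
      unfolding differentiable_on_def differentiable_def
      using f' has_derivative_at_withinI by blast
    fix x i assume x: "x \<in> ball z \<rho>'"
    have "((\<lambda>t. f (x + t *\<^sub>R axis i 1)) has_derivative (\<lambda>t. g' x (t *\<^sub>R axis i 1))) (at 0)"
      by (rule has_derivative_compose[of "\<lambda>t. x + t *\<^sub>R axis i 1" "\<lambda>t. t *\<^sub>R axis i 1" 0 _ f "g' x"])
         (use f'[OF x] in \<open>auto intro!: derivative_eq_intros\<close>)
    moreover have "g' x (t *\<^sub>R axis i 1) = t *\<^sub>R infsum (\<lambda>p. d i p x) UNIV" for t
      unfolding g'_def by (subst sum.remove[of UNIV i]) (auto simp: axis_def scaleR_conv_of_real[where 'a = complex])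
    ultimately have "((\<lambda>t. f (x + t *\<^sub>R axis i 1)) has_vector_derivative infsum (\<lambda>p. d i p x) UNIV) (at 0)"
      by (simp add: has_vector_derivative_def)
    then have pd: "pderiv_at i f x = infsum (\<lambda>p. d i p x) UNIV"
      unfolding pderiv_at_def by (rule vector_derivative_at)
    have "((\<lambda>p. d i p x) has_sum pderiv_at i f x) UNIV"
      unfolding pd by (rule has_sum_infsum[OF dsum[OF x]])
    \<comment> \<open>Terms with \<open>p i = 0\<close> vanish, so restricting to the shifted
      multi-indices loses nothing; reindexing by the shift then yields the coefficients in the
      stated form.\<close>
    moreover have "((\<lambda>p. d i p x) has_sum pderiv_at i f x) (range (\<lambda>p :: 'n \<Rightarrow> nat. p(i := p i + 1)))
        \<longleftrightarrow> ((\<lambda>p. d i p x) has_sum pderiv_at i f x) UNIV"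
    proof (rule has_sum_cong_neutral)
      fix p :: "'n \<Rightarrow> nat" assume "p \<in> UNIV - range (\<lambda>p. p(i := p i + 1))"
      then have "p \<noteq> (p(i := p i - 1))(i := (p(i := p i - 1)) i + 1)" by blast
      then have "p i = 0" by (auto simp: fun_eq_iff split: if_splits)
      then show "d i p x = 0" by (simp add: d_def)
    qed auto
    moreover have "inj (\<lambda>p::'n \<Rightarrow> nat. p(i := p i + 1))"
    proof (rule injI)
      fix p q :: "'n \<Rightarrow> nat" assume eq: "p(i := p i + 1) = q(i := q i + 1)"
      show "p = q"
      proof
        fix j show "p j = q j" using fun_cong[OF eq, of j] by (auto split: if_splits)
      qed
    qed
    ultimately have "((\<lambda>p. d i p x) \<circ> (\<lambda>p. p(i := p i + 1)) has_sum pderiv_at i f x) UNIV"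
      using has_sum_reindex by blast
    then show "((\<lambda>p. of_nat (p i + 1) * c (p(i := p i + 1)) * of_real (mi_power (x - z) p)) has_sum pderiv_at i f x) UNIV"
      by (simp add: d_def o_def mult_ac)
  qed
qed

lemma real_analytic_at_differentiable:
  assumes "real_analytic_at f z"
  shows "f differentiable (at z)"
proof -
  obtain c \<rho> where c: "\<rho> > 0"
    "\<And>x. x \<in> ball z \<rho> \<Longrightarrow> ((\<lambda>p. c p * of_real (mi_power (x - z) p)) has_sum f x) UNIV"
    using assms unfolding real_analytic_at_def by blast
  obtain \<rho>' where \<rho>': "\<rho>' > 0" "f differentiable_on ball z \<rho>'"
    by (rule power_series_pderiv[OF c]) blast+
  then show ?thesis
    by (metis centre_in_ball differentiable_on_eq_differentiable_at open_ball)
qed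

lemma real_analytic_at_pderiv:
  assumes "real_analytic_at f z"
  shows "real_analytic_at (pderiv_at i f) z"
proof -
  obtain c \<rho> where c: "\<rho> > 0"
    "\<And>x. x \<in> ball z \<rho> \<Longrightarrow> ((\<lambda>p. c p * of_real (mi_power (x - z) p)) has_sum f x) UNIV"
    using assms unfolding real_analytic_at_def by blast
  show ?thesis
  proof (rule power_series_pderiv[OF c])
    fix \<rho>' assume "\<rho>' > 0" and "\<And>x i. x \<in> ball z \<rho>' \<Longrightarrow>
      ((\<lambda>p. of_nat (p i + 1) * c (p(i := p i + 1)) * of_real (mi_power (x - z) p)) has_sum pderiv_at i f x) UNIV"
    then show ?thesis
      unfolding real_analytic_at_def
      by (intro exI[of _ "\<lambda>p. of_nat (p i + 1) * c (p(i := p i + 1))"] exI[of _ \<rho>']) auto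
  qed
qed

text \<open>The mixed second derivatives at the centre are coefficients of the twice differentiated
  series, and these are visibly symmetric.\<close>

lemma real_analytic_at_pderiv_commute:
  assumes "real_analytic_at f z"
  shows "pderiv_at i (pderiv_at j f) z = pderiv_at j (pderiv_at i f) z"
proof -
  obtain c \<rho> where c: "\<rho> > 0"
    "\<And>x. x \<in> ball z \<rho> \<Longrightarrow> ((\<lambda>p. c p * of_real (mi_power (x - z) p)) has_sum f x) UNIV"
    using assms unfolding real_analytic_at_def by blast
  obtain \<rho>' where \<rho>': "\<rho>' > 0" and 1: "\<And>x i. x \<in> ball z \<rho>' \<Longrightarrow>
      ((\<lambda>p. of_nat (p i + 1) * c (p(i := p i + 1)) * of_real (mi_power (x - z) p)) has_sum pderiv_at i f x) UNIV"
  proof (rule power_series_pderiv[OF c])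
    fix \<rho>' assume "\<rho>' > 0" and "\<And>x i. x \<in> ball z \<rho>' \<Longrightarrow>
      ((\<lambda>p. of_nat (p i + 1) * c (p(i := p i + 1)) * of_real (mi_power (x - z) p)) has_sum pderiv_at i f x) UNIV"
    then show thesis by (rule that)
  qed
  \<comment> \<open>At the centre only the zero multi-index contributes; it carries the original
    coefficient at the sum of the unit multi-indices of \<open>k\<close> and \<open>l\<close>, and
    the 2 for \<open>k = l\<close> is \<open>2!\<close>.\<close>
  have eq: "pderiv_at k (pderiv_at l f) z
      = (if k = l then 2 else 1) * c ((\<lambda>_. 0)(k := 1, l := (if k = l then 2 else 1)))" for k l
  proof -
    define c' where "c' = (\<lambda>p. of_nat (p l + 1) * c (p(l := p l + 1)))"
    have c': "((\<lambda>p. c' p * of_real (mi_power (x - z) p)) has_sum pderiv_at l f x) UNIV" if "x \<in> ball z \<rho>'" for x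
      using 1[OF that] by (simp add: c'_def)
    obtain \<rho>'' where "\<rho>'' > 0" and 2: "\<And>x i. x \<in> ball z \<rho>'' \<Longrightarrow>
      ((\<lambda>p. of_nat (p i + 1) * c' (p(i := p i + 1)) * of_real (mi_power (x - z) p)) has_sum pderiv_at i (pderiv_at l f) x) UNIV"
    proof (rule power_series_pderiv[OF \<rho>' c'])
      fix \<rho>'' assume "\<rho>'' > 0" and "\<And>x i. x \<in> ball z \<rho>'' \<Longrightarrow>
        ((\<lambda>p. of_nat (p i + 1) * c' (p(i := p i + 1)) * of_real (mi_power (x - z) p)) has_sum pderiv_at i (pderiv_at l f) x) UNIV"
      then show thesis by (rule that)
    qed
    then have "((\<lambda>p. of_nat (p k + 1) * c' (p(k := p k + 1)) * of_real (mi_power 0 p)) has_sum pderiv_at k (pderiv_at l f) z) UNIV"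
      using 2[of z k] by simp
    moreover have "((\<lambda>p. of_nat (p k + 1) * c' (p(k := p k + 1)) * of_real (mi_power 0 p)) has_sum
       (\<Sum>p\<in>{\<lambda>_. 0}. of_nat (p k + 1) * c' (p(k := p k + 1)) * of_real (mi_power 0 p))) UNIV"
    proof (rule has_sum_finite_neutralI)
      fix p :: "'a \<Rightarrow> nat" assume "p \<in> UNIV - {\<lambda>_. 0}"
      then obtain j where "p j \<noteq> 0" by (auto simp: fun_eq_iff)
      then have "mi_power 0 p = 0"
        by (auto simp: mi_power_def intro!: prod_zero)
      then show "of_nat (p k + 1) * c' (p(k := p k + 1)) * of_real (mi_power 0 p) = 0" by simp
    qed auto
    ultimately have "pderiv_at k (pderiv_at l f) z
        = (\<Sum>p\<in>{\<lambda>_. 0}. of_nat (p k + 1) * c' (p(k := p k + 1)) * of_real (mi_power 0 p))"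
      by (rule has_sum_unique)
    also have "\<dots> = (if k = l then 2 else 1) * c ((\<lambda>_. 0)(k := 1, l := (if k = l then 2 else 1)))"
      by (auto simp: c'_def mi_power_def intro!: arg_cong[where f = c])
    finally show ?thesis .
  qed
  show ?thesis
    unfolding eq by (auto simp: fun_upd_twist)
qed

lemma real_analytic_on_foldr_pderiv:
  "real_analytic_on f S \<Longrightarrow> real_analytic_on (foldr pderiv_at js f) S"
  by (induction js) (auto simp: real_analytic_on_def intro: real_analytic_at_pderiv)

lemma real_analytic_on_imp_smooth_on:
  "real_analytic_on f S \<Longrightarrow> smooth_on f S"
  using real_analytic_on_foldr_pderiv[of f S]
  by (auto simp: smooth_on_def differentiable_on_def real_analytic_on_def
      intro!: differentiable_at_withinI real_analytic_at_differentiable)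

subsection \<open>Calculus of smooth functions\<close>

abbreviation pderivs :: "'n list \<Rightarrow> (real ^ 'n \<Rightarrow> complex) \<Rightarrow> real ^ 'n \<Rightarrow> complex" where
  "pderivs js f \<equiv> foldr pderiv_at js f"

lemma pderiv_at_eq: "(f has_derivative f') (at x) \<Longrightarrow> pderiv_at i f x = f' (axis i 1)"
proof -
  assume f: "(f has_derivative f') (at x)"
  have "((\<lambda>t. f (x + t *\<^sub>R axis i 1)) has_derivative (\<lambda>t. f' (t *\<^sub>R axis i 1))) (at 0)"
    by (rule has_derivative_compose[of "\<lambda>t. x + t *\<^sub>R axis i 1" "\<lambda>t. t *\<^sub>R axis i 1" 0 _ f f'])
       (use f in \<open>auto intro!: derivative_eq_intros\<close>)
  then have "((\<lambda>t. f (x + t *\<^sub>R axis i 1)) has_vector_derivative f' (axis i 1)) (at 0)"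
    using has_derivative_linear[OF f] by (simp add: has_vector_derivative_def linear_cmul)
  then show ?thesis
    unfolding pderiv_at_def by (rule vector_derivative_at)
qed

lemma pderiv_at_cong:
  assumes "open S" "x \<in> S" "\<And>y. y \<in> S \<Longrightarrow> f y = g y"
  shows "pderiv_at i f x = pderiv_at i g x"
proof -
  have "((\<lambda>t. x + t *\<^sub>R axis i 1) \<longlongrightarrow> x + 0 *\<^sub>R axis i 1) (nhds (0::real))"
    by (intro tendsto_intros filterlim_ident)
  then have "eventually (\<lambda>t. x + t *\<^sub>R axis i 1 \<in> S) (nhds (0::real))"
    using assms by (auto dest: topological_tendstoD)
  then have "eventually (\<lambda>t. t \<in> UNIV \<longrightarrow> f (x + t *\<^sub>R axis i 1) = g (x + t *\<^sub>R axis i 1)) (nhds (0::real))"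
    by eventually_elim (use assms in auto)
  then show ?thesis
    unfolding pderiv_at_def by (rule vector_derivative_cong_eq) auto
qed

lemma pderivs_cong:
  assumes "open S" "x \<in> S" "\<And>y. y \<in> S \<Longrightarrow> f y = g y"
  shows "pderivs js f x = pderivs js g x"
  using assms(2)
proof (induction js arbitrary: x)
  case (Cons i js)
  then show ?case using assms(1) by (auto intro: pderiv_at_cong)
qed (use assms in auto)

lemma pderiv_at_add_differentiable:
  assumes "f differentiable (at x)" "g differentiable (at x)"
  shows "pderiv_at i (\<lambda>x. f x + g x) x = pderiv_at i f x + pderiv_at i g x"
proof -
  obtain f' g' where *: "(f has_derivative f') (at x)" "(g has_derivative g') (at x)"
    using assms unfolding differentiable_def by blast
  show ?thesis
    using pderiv_at_eq[OF has_derivative_add[OF *]] pderiv_at_eq[OF *(1)] pderiv_at_eq[OF *(2)] by simp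
qed

lemma smooth_on_imp_differentiable_on: "smooth_on f S \<Longrightarrow> f differentiable_on S"
  unfolding smooth_on_def by (metis foldr.simps(1) id_apply)

lemma smooth_on_pderivs: "smooth_on f S \<Longrightarrow> smooth_on (pderivs js f) S"
  unfolding smooth_on_def by (metis foldr_append)

lemma smooth_on_pderiv_at: "smooth_on f S \<Longrightarrow> smooth_on (pderiv_at i f) S"
  using smooth_on_pderivs[of f S "[i]"] by simp

lemma smooth_on_subset: "smooth_on f S \<Longrightarrow> T \<subseteq> S \<Longrightarrow> smooth_on f T"
  unfolding smooth_on_def by (meson differentiable_on_subset)

lemma differentiable_on_cong:
  "(\<And>x. x \<in> S \<Longrightarrow> f x = g x) \<Longrightarrow> f differentiable_on S \<longleftrightarrow> g differentiable_on S"
  unfolding differentiable_on_def differentiable_def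
  by (metis has_derivative_transform)

lemma smooth_on_cong:
  assumes "open S" "\<And>y. y \<in> S \<Longrightarrow> f y = g y"
  shows "smooth_on f S \<longleftrightarrow> smooth_on g S"
proof -
  have "pderivs js f differentiable_on S \<longleftrightarrow> pderivs js g differentiable_on S" for js
    by (rule differentiable_on_cong) (use pderivs_cong[OF assms(1) _ assms(2)] in auto)
  then show ?thesis by (simp add: smooth_on_def)
qed

locale open_domain =
  fixes S :: "(real ^ 'n) set"
  assumes S: "open S"
begin

lemma smooth_differentiable: "smooth_on f S \<Longrightarrow> x \<in> S \<Longrightarrow> f differentiable (at x)"
  using smooth_on_imp_differentiable_on S differentiable_on_eq_differentiable_at by blast

lemma smooth_has_derivative:
  assumes "smooth_on f S" "x \<in> S"
  obtains f' where "(f has_derivative f') (at x)" "\<And>i. pderiv_at i f x = f' (axis i 1)"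
  using smooth_differentiable[OF assms] pderiv_at_eq unfolding differentiable_def by blast

lemma pderiv_at_add:
  assumes "smooth_on f S" "smooth_on g S" "x \<in> S"
  shows "pderiv_at i (\<lambda>x. f x + g x) x = pderiv_at i f x + pderiv_at i g x"
  using assms by (intro pderiv_at_add_differentiable smooth_differentiable)

lemma pderiv_at_mult:
  assumes "smooth_on f S" "smooth_on g S" "x \<in> S"
  shows "pderiv_at i (\<lambda>x. f x * g x) x = pderiv_at i f x * g x + f x * pderiv_at i g x"
proof -
  obtain f' g' where *: "(f has_derivative f') (at x)" "pderiv_at i f x = f' (axis i 1)"
    "(g has_derivative g') (at x)" "pderiv_at i g x = g' (axis i 1)"
    by (metis smooth_has_derivative assms)
  show ?thesis
    using pderiv_at_eq[OF has_derivative_mult[OF *(1,3)]] * by simp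
qed

lemma pderiv_at_const: "pderiv_at i (\<lambda>x. c) = (\<lambda>x. 0)"
  by (rule ext) (rule pderiv_at_eq[OF has_derivative_const])

lemma smooth_const: "smooth_on (\<lambda>x. c) S"
proof -
  have const: "\<exists>c'. pderivs js (\<lambda>x. c) = (\<lambda>x. c')" for js :: "'n list"
    by (induction js) (auto simp: pderiv_at_const)
  show ?thesis
    unfolding smooth_on_def
  proof
    fix js :: "'n list"
    obtain c' where "pderivs js (\<lambda>x. c) = (\<lambda>x. c')"
      using const by blast
    then show "pderivs js (\<lambda>x. c) differentiable_on S" by simp
  qed
qed

lemma pderivs_add:
  assumes "smooth_on f S" "smooth_on g S" "x \<in> S"
  shows "pderivs js (\<lambda>x. f x + g x) x = pderivs js f x + pderivs js g x"
  using assms(3)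
proof (induction js arbitrary: x)
  case (Cons i js)
  have "pderiv_at i (pderivs js (\<lambda>x. f x + g x)) x = pderiv_at i (\<lambda>x. pderivs js f x + pderivs js g x) x"
    using Cons by (intro pderiv_at_cong[OF S]) auto
  then show ?case
    using Cons.prems assms by (simp add: pderiv_at_add smooth_on_pderivs)
qed auto

lemma smooth_add:
  assumes "smooth_on f S" "smooth_on g S"
  shows "smooth_on (\<lambda>x. f x + g x) S"
  unfolding smooth_on_def
proof
  fix js
  have "(\<lambda>x. pderivs js f x + pderivs js g x) differentiable_on S"
    using assms by (auto simp: smooth_on_def)
  then show "pderivs js (\<lambda>x. f x + g x) differentiable_on S"
    by (subst differentiable_on_cong[OF pderivs_add[OF assms]])
qed

lemma pderivs_mult_snoc:
  assumes "smooth_on f S" "smooth_on g S" "x \<in> S"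
    and "smooth_on (\<lambda>x. pderiv_at i f x * g x) S" "smooth_on (\<lambda>x. f x * pderiv_at i g x) S"
  shows "pderivs (js @ [i]) (\<lambda>x. f x * g x) x =
    pderivs js (\<lambda>x. pderiv_at i f x * g x) x + pderivs js (\<lambda>x. f x * pderiv_at i g x) x"
proof -
  have "pderivs (js @ [i]) (\<lambda>x. f x * g x) x
      = pderivs js (\<lambda>x. pderiv_at i f x * g x + f x * pderiv_at i g x) x"
    using assms by (simp, intro pderivs_cong[OF S]) (auto simp: pderiv_at_mult)
  then show ?thesis using assms by (simp add: pderivs_add)
qed

text \<open>The product rule is applied at the innermost derivative, with induction on a length
  bound for all pairs of factors at once. Quoting \<open>pderivs_add\<close> for the two resulting
  products would presuppose that they are smooth; the inner induction re-proves additivity for words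
  of length at most \<open>n\<close>, where the hypothesis supplies the differentiability.\<close>

lemma smooth_mult:
  assumes "smooth_on f S" "smooth_on g S"
  shows "smooth_on (\<lambda>x. f x * g x) S"
proof -
  have "pderivs js (\<lambda>x. f x * g x) differentiable_on S"
    if "length js \<le> n" "smooth_on f S" "smooth_on g S" for js n f g
    using that
  proof (induction n arbitrary: js f g)
    case 0
    then show ?case by (auto intro: differentiable_on_mult smooth_on_imp_differentiable_on)
  next
    case (Suc n)
    show ?case
    proof (cases js rule: rev_cases)
      case Nil
      then show ?thesis using Suc.prems by (auto intro: differentiable_on_mult smooth_on_imp_differentiable_on)
    next
      case (snoc ks i)
      then have l: "length ks \<le> n" using Suc.prems by simp
      have *: "pderivs ls (\<lambda>x. pderiv_at i f x * g x + f x * pderiv_at i g x) x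
          = pderivs ls (\<lambda>x. pderiv_at i f x * g x) x + pderivs ls (\<lambda>x. f x * pderiv_at i g x) x"
        if "length ls \<le> n" "x \<in> S" for ls x
        using that
      proof (induction ls arbitrary: x)
        case (Cons k ls)
        have d: "pderivs ls (\<lambda>x. pderiv_at i f x * g x) differentiable_on S"
          "pderivs ls (\<lambda>x. f x * pderiv_at i g x) differentiable_on S"
          using Suc.prems Cons.prems by (auto intro!: Suc.IH smooth_on_pderiv_at)
        have "pderiv_at k (pderivs ls (\<lambda>x. pderiv_at i f x * g x + f x * pderiv_at i g x)) x =
           pderiv_at k (\<lambda>x. pderivs ls (\<lambda>x. pderiv_at i f x * g x) x + pderivs ls (\<lambda>x. f x * pderiv_at i g x) x) x"
          using Cons by (intro pderiv_at_cong[OF S]) auto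
        then show ?case
          using d Cons.prems by (simp add: pderiv_at_add_differentiable differentiable_on_eq_differentiable_at[OF S])
      qed simp
      have "(\<lambda>x. pderivs ks (\<lambda>x. pderiv_at i f x * g x) x + pderivs ks (\<lambda>x. f x * pderiv_at i g x) x) differentiable_on S"
        using Suc.prems l by (auto intro!: Suc.IH smooth_on_pderiv_at differentiable_on_add)
      then have "pderivs ks (\<lambda>x. pderiv_at i f x * g x + f x * pderiv_at i g x) differentiable_on S"
        by (subst differentiable_on_cong[OF *[OF l]])
      moreover have "pderivs js (\<lambda>x. f x * g x) x = pderivs ks (\<lambda>x. pderiv_at i f x * g x + f x * pderiv_at i g x) x"
        if "x \<in> S" for x
        using Suc.prems that by (simp add: snoc, intro pderivs_cong[OF S]) (auto simp: pderiv_at_mult)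
      ultimately show ?thesis
        by (subst differentiable_on_cong) auto
    qed
  qed
  then show ?thesis using assms by (auto simp: smooth_on_def)
qed

lemma smooth_cmult: "smooth_on f S \<Longrightarrow> smooth_on (\<lambda>x. c * f x) S"
  by (intro smooth_mult smooth_const)

lemma smooth_sum: "(\<And>q. q \<in> Q \<Longrightarrow> smooth_on (f q) S) \<Longrightarrow> smooth_on (\<lambda>x. \<Sum>q\<in>Q. f q x) S"
  by (induction Q rule: infinite_finite_induct) (auto intro!: smooth_const smooth_add)

lemma pderiv_at_cmult: "smooth_on f S \<Longrightarrow> x \<in> S \<Longrightarrow> pderiv_at i (\<lambda>x. c * f x) x = c * pderiv_at i f x"
  using pderiv_at_mult[OF smooth_const] by (simp add: pderiv_at_const)

lemma pderiv_at_sum: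
  "(\<And>q. q \<in> Q \<Longrightarrow> smooth_on (f q) S) \<Longrightarrow> x \<in> S \<Longrightarrow>
   pderiv_at i (\<lambda>x. \<Sum>q\<in>Q. f q x) x = (\<Sum>q\<in>Q. pderiv_at i (f q) x)"
  by (induction Q rule: infinite_finite_induct) (auto simp: pderiv_at_const pderiv_at_add smooth_sum)

lemma pderivs_cmult:
  assumes "smooth_on f S" "x \<in> S"
  shows "pderivs js (\<lambda>x. c * f x) x = c * pderivs js f x"
  using assms(2)
proof (induction js arbitrary: x)
  case (Cons i js)
  have "pderiv_at i (pderivs js (\<lambda>x. c * f x)) x = pderiv_at i (\<lambda>x. c * pderivs js f x) x"
    using Cons by (intro pderiv_at_cong[OF S]) auto
  then show ?case
    using Cons.prems assms by (simp add: pderiv_at_cmult smooth_on_pderivs)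
qed auto

end

subsection \<open>One-sided powers and exponentials\<close>

text \<open>Extension by zero makes the power smooth off the whole hyperplane. This matters because
  the commutation relation can be tested only on functions smooth on all of \<open>D\<close>, which
  has points on both sides of the wall.\<close>

definition wpow :: "real ^ 'n \<Rightarrow> real \<Rightarrow> real ^ 'n \<Rightarrow> complex" where
  "wpow \<alpha> s x = (if \<alpha> \<bullet> x > 0 then of_real ((\<alpha> \<bullet> x) powr s) else 0)"

lemma open_inner_nonzero: "open {x. \<alpha> \<bullet> x \<noteq> 0}"
  by (intro open_Collect_neq continuous_intros)

lemma open_inner_pos: "open {x. 0 < \<alpha> \<bullet> x}"
  by (intro open_Collect_less continuous_intros)

lemma wpow_has_derivative:
  assumes "\<alpha> \<bullet> x \<noteq> 0"
  shows "(wpow \<alpha> s has_derivative (\<lambda>h. of_real (s * (\<alpha> \<bullet> h)) * wpow \<alpha> (s - 1) x)) (at x)"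
proof (cases "\<alpha> \<bullet> x > 0")
  case True
  have "((\<lambda>x. of_real ((\<alpha> \<bullet> x) powr s)) has_derivative
      (\<lambda>h. of_real (s * (\<alpha> \<bullet> h)) * wpow \<alpha> (s - 1) x)) (at x)"
    by (rule has_derivative_eq_rhs)
       (use True in \<open>auto intro!: derivative_eq_intros bounded_linear.has_derivative[OF bounded_linear_of_real]
          simp: wpow_def powr_diff field_simps\<close>)
  then show ?thesis
    by (rule has_derivative_transform_within_open[OF _ open_inner_pos[of \<alpha>]])
       (use True in \<open>auto simp: wpow_def\<close>)
next
  case False
  then have neg: "\<alpha> \<bullet> x < 0" using assms by linarith
  have "open {x. \<alpha> \<bullet> x < 0}" by (intro open_Collect_less continuous_intros)
  then have "(wpow \<alpha> s has_derivative (\<lambda>h. 0)) (at x)"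
    by (rule has_derivative_transform_within_open[OF has_derivative_const[of 0]])
       (use neg in \<open>auto simp: wpow_def\<close>)
  then show ?thesis using False by (simp add: wpow_def)
qed

lemma pderiv_at_cmult_wpow:
  "\<alpha> \<bullet> x \<noteq> 0 \<Longrightarrow> pderiv_at i (\<lambda>x. c * wpow \<alpha> s x) x = c * of_real (s * \<alpha> $ i) * wpow \<alpha> (s - 1) x"
  by (subst pderiv_at_eq[OF has_derivative_mult_right[OF wpow_has_derivative]]) (auto simp: inner_axis)

lemma pderivs_wpow:
  obtains c where "\<And>x. \<alpha> \<bullet> x \<noteq> 0 \<Longrightarrow> pderivs js (wpow \<alpha> s) x = c * wpow \<alpha> (s - length js) x"
proof (induction js arbitrary: thesis)
  case Nil
  show ?case by (rule Nil[of 1]) simp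
next
  case (Cons i js)
  obtain c where c: "\<And>x. \<alpha> \<bullet> x \<noteq> 0 \<Longrightarrow> pderivs js (wpow \<alpha> s) x = c * wpow \<alpha> (s - length js) x"
    using Cons.IH by blast
  show ?case
  proof (rule Cons.prems)
    fix x assume x: "\<alpha> \<bullet> x \<noteq> 0"
    have "pderiv_at i (pderivs js (wpow \<alpha> s)) x = pderiv_at i (\<lambda>x. c * wpow \<alpha> (s - length js) x) x"
      by (rule pderiv_at_cong[OF open_inner_nonzero]) (use x c in auto)
    also have "\<dots> = c * of_real ((s - length js) * \<alpha> $ i) * wpow \<alpha> (s - length js - 1) x"
      by (rule pderiv_at_cmult_wpow[OF x])
    finally show "pderivs (i # js) (wpow \<alpha> s) x
        = c * of_real ((s - length js) * \<alpha> $ i) * wpow \<alpha> (s - length (i # js)) x"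
      by (simp add: algebra_simps)
  qed
qed

lemma smooth_on_wpow: "smooth_on (wpow \<alpha> s) {x. \<alpha> \<bullet> x \<noteq> 0}"
  unfolding smooth_on_def
proof
  fix js
  obtain c where c: "\<And>x. \<alpha> \<bullet> x \<noteq> 0 \<Longrightarrow> pderivs js (wpow \<alpha> s) x = c * wpow \<alpha> (s - length js) x"
    using pderivs_wpow by blast
  have "(\<lambda>x. c * wpow \<alpha> (s - length js) x) differentiable_on {x. \<alpha> \<bullet> x \<noteq> 0}"
    unfolding differentiable_on_eq_differentiable_at[OF open_inner_nonzero] differentiable_def
    by (blast intro: has_derivative_mult_right wpow_has_derivative)
  then show "pderivs js (wpow \<alpha> s) differentiable_on {x. \<alpha> \<bullet> x \<noteq> 0}"
    by (subst differentiable_on_cong[OF c]) auto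
qed

text \<open>The function is glued from the one-sided powers for \<alpha> and
  \<open>-\<alpha>\<close>, each of which vanishes on the side of the other.\<close>

lemma smooth_on_inverse_square: "smooth_on (\<lambda>x. 1 / of_real ((\<alpha> \<bullet> x)\<^sup>2)) {x. \<alpha> \<bullet> x \<noteq> 0}"
proof -
  interpret open_domain "{x. \<alpha> \<bullet> x \<noteq> 0}" by unfold_locales (rule open_inner_nonzero)
  have "smooth_on (wpow (-\<alpha>) (-2)) {x. \<alpha> \<bullet> x \<noteq> 0}"
    using smooth_on_wpow[of "-\<alpha>" "-2"] by simp
  then have "smooth_on (\<lambda>x. wpow \<alpha> (-2) x + wpow (-\<alpha>) (-2) x) {x. \<alpha> \<bullet> x \<noteq> 0}"
    by (intro smooth_add smooth_on_wpow)
  moreover have "wpow \<alpha> (-2) x + wpow (-\<alpha>) (-2) x = 1 / of_real ((\<alpha> \<bullet> x)\<^sup>2)" if "\<alpha> \<bullet> x \<noteq> 0" for x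
    using that by (auto simp: wpow_def powr_minus powr_numeral field_simps not_less)
  ultimately show ?thesis
    by (subst smooth_on_cong[OF S, of _ "\<lambda>x. wpow \<alpha> (-2) x + wpow (-\<alpha>) (-2) x"]) auto
qed

definition expw :: "real ^ 'n \<Rightarrow> real ^ 'n \<Rightarrow> complex" where
  "expw \<xi> x = of_real (exp (\<xi> \<bullet> x))"

lemma expw_has_derivative: "(expw \<xi> has_derivative (\<lambda>h. of_real (\<xi> \<bullet> h) * expw \<xi> x)) (at x)"
  unfolding expw_def[abs_def]
  by (rule has_derivative_eq_rhs)
     (auto intro!: derivative_eq_intros bounded_linear.has_derivative[OF bounded_linear_of_real])

lemma pderiv_at_expw: "pderiv_at i (expw \<xi>) = (\<lambda>x. of_real (\<xi> $ i) * expw \<xi> x)"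
  by (rule ext) (simp add: pderiv_at_eq[OF expw_has_derivative] inner_axis)

lemma smooth_on_expw: "smooth_on (expw \<xi>) S"
proof -
  have *: "\<exists>c. pderivs js (expw \<xi>) = (\<lambda>x. c * expw \<xi> x)" for js
  proof (induction js)
    case (Cons i js)
    then obtain c where c: "pderivs js (expw \<xi>) = (\<lambda>x. c * expw \<xi> x)" by blast
    have "pderiv_at i (\<lambda>x. c * expw \<xi> x) = (\<lambda>x. (c * of_real (\<xi> $ i)) * expw \<xi> x)"
      by (rule ext) (simp add: pderiv_at_eq[OF has_derivative_mult_right[OF expw_has_derivative]] inner_axis)
    then show ?case by (auto simp: c)
  qed (auto intro: exI[of _ 1])
  have "(\<lambda>x. c * expw \<xi> x) differentiable_on S" for c
    unfolding differentiable_on_def differentiable_def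
    by (blast intro: has_derivative_mult_right has_derivative_at_withinI expw_has_derivative)
  then show ?thesis
    unfolding smooth_on_def using * by metis
qed

lemma expw_nonzero: "expw \<xi> x \<noteq> 0"
  by (simp add: expw_def)

subsection \<open>Commuting derivatives\<close>

text \<open>Integrating the transport equation for all iterated derivatives requires moving them
  past the derivative along a line. The symmetry is carried as a property of its own, read off from
  power series for the coefficients and from explicit formulas for the powers.\<close>

definition derivs_commute_on :: "(real ^ 'n \<Rightarrow> complex) \<Rightarrow> (real ^ 'n) set \<Rightarrow> bool" where
  "derivs_commute_on f S \<longleftrightarrow>
    (\<forall>js i. \<forall>x\<in>S. pderivs js (pderiv_at i f) x = pderiv_at i (pderivs js f) x)"

lemma derivs_commute_onI:
  assumes "open S"
    and "\<And>js i k x. x \<in> S \<Longrightarrow>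
      pderiv_at i (pderiv_at k (pderivs js f)) x = pderiv_at k (pderiv_at i (pderivs js f)) x"
  shows "derivs_commute_on f S"
proof -
  have "pderivs js (pderiv_at i f) x = pderiv_at i (pderivs js f) x" if "x \<in> S" for js i x
    using that
  proof (induction js arbitrary: x)
    case (Cons k js)
    have "pderiv_at k (pderivs js (pderiv_at i f)) x = pderiv_at k (pderiv_at i (pderivs js f)) x"
      using Cons by (intro pderiv_at_cong[OF assms(1)]) auto
    then show ?case using assms(2) Cons.prems by simp
  qed simp
  then show ?thesis by (simp add: derivs_commute_on_def)
qed

lemma derivs_commute_on_subset: "derivs_commute_on f S \<Longrightarrow> T \<subseteq> S \<Longrightarrow> derivs_commute_on f T"
  by (auto simp: derivs_commute_on_def)

lemma real_analytic_on_derivs_commute: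
  "open S \<Longrightarrow> real_analytic_on f S \<Longrightarrow> derivs_commute_on f S"
  using real_analytic_on_foldr_pderiv[of f S]
  by (intro derivs_commute_onI) (auto simp: real_analytic_on_def intro: real_analytic_at_pderiv_commute)

lemma derivs_commute_wpow: "derivs_commute_on (wpow \<alpha> s) {x. \<alpha> \<bullet> x \<noteq> 0}"
proof (rule derivs_commute_onI[OF open_inner_nonzero])
  fix js i k x assume "x \<in> {x. \<alpha> \<bullet> x \<noteq> 0}"
  then have x: "\<alpha> \<bullet> x \<noteq> 0" by simp
  obtain c where c: "\<And>x. \<alpha> \<bullet> x \<noteq> 0 \<Longrightarrow> pderivs js (wpow \<alpha> s) x = c * wpow \<alpha> (s - length js) x"
    using pderivs_wpow by blast
  define t where "t = s - length js"
  have 1: "pderiv_at k (pderivs js (wpow \<alpha> s)) y = c * of_real (t * \<alpha> $ k) * wpow \<alpha> (t - 1) y"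
    if "\<alpha> \<bullet> y \<noteq> 0" for y k
    using pderiv_at_cong[OF open_inner_nonzero, of y \<alpha> "pderivs js (wpow \<alpha> s)" "\<lambda>x. c * wpow \<alpha> t x" k]
      pderiv_at_cmult_wpow[OF that] that c by (auto simp: t_def)
  have 2: "pderiv_at i (pderiv_at k (pderivs js (wpow \<alpha> s))) x
      = c * of_real (t * \<alpha> $ k) * of_real ((t - 1) * \<alpha> $ i) * wpow \<alpha> (t - 1 - 1) x" for i k
    using pderiv_at_cong[OF open_inner_nonzero, of x \<alpha> "pderiv_at k (pderivs js (wpow \<alpha> s))"
        "\<lambda>y. c * of_real (t * \<alpha> $ k) * wpow \<alpha> (t - 1) y" i]
      pderiv_at_cmult_wpow[OF x] x 1 by simp
  show "pderiv_at i (pderiv_at k (pderivs js (wpow \<alpha> s))) x = pderiv_at k (pderiv_at i (pderivs js (wpow \<alpha> s))) x"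
    unfolding 2 by (simp add: mult_ac)
qed

context open_domain
begin

lemma derivs_commute_add:
  assumes "derivs_commute_on f S" "derivs_commute_on g S" "smooth_on f S" "smooth_on g S"
  shows "derivs_commute_on (\<lambda>x. f x + g x) S"
  unfolding derivs_commute_on_def
proof (intro allI ballI)
  fix js i x assume x: "x \<in> S"
  have "pderivs js (pderiv_at i (\<lambda>x. f x + g x)) x = pderivs js (\<lambda>x. pderiv_at i f x + pderiv_at i g x) x"
    using assms x by (intro pderivs_cong[OF S]) (auto simp: pderiv_at_add)
  also have "\<dots> = pderiv_at i (pderivs js f) x + pderiv_at i (pderivs js g) x"
    using assms x by (simp add: pderivs_add smooth_on_pderiv_at derivs_commute_on_def)
  also have "\<dots> = pderiv_at i (\<lambda>x. pderivs js f x + pderivs js g x) x"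
    using assms x by (simp add: pderiv_at_add smooth_on_pderivs)
  also have "\<dots> = pderiv_at i (pderivs js (\<lambda>x. f x + g x)) x"
    using assms x by (intro pderiv_at_cong[OF S]) (auto simp: pderivs_add)
  finally show "pderivs js (pderiv_at i (\<lambda>x. f x + g x)) x = pderiv_at i (pderivs js (\<lambda>x. f x + g x)) x" .
qed

lemma derivs_commute_cmult:
  assumes "derivs_commute_on f S" "smooth_on f S"
  shows "derivs_commute_on (\<lambda>x. c * f x) S"
  unfolding derivs_commute_on_def
proof (intro allI ballI)
  fix js i x assume x: "x \<in> S"
  have "pderivs js (pderiv_at i (\<lambda>x. c * f x)) x = pderivs js (\<lambda>x. c * pderiv_at i f x) x"
    using assms x by (intro pderivs_cong[OF S]) (auto simp: pderiv_at_cmult)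
  also have "\<dots> = c * pderiv_at i (pderivs js f) x"
    using assms x by (simp add: pderivs_cmult smooth_on_pderiv_at derivs_commute_on_def)
  also have "\<dots> = pderiv_at i (\<lambda>x. c * pderivs js f x) x"
    using assms x by (simp add: pderiv_at_cmult smooth_on_pderivs)
  also have "\<dots> = pderiv_at i (pderivs js (\<lambda>x. c * f x)) x"
    using assms x by (intro pderiv_at_cong[OF S]) (auto simp: pderivs_cmult)
  finally show "pderivs js (pderiv_at i (\<lambda>x. c * f x)) x = pderiv_at i (pderivs js (\<lambda>x. c * f x)) x" .
qed

lemma derivs_commute_const: "derivs_commute_on (\<lambda>x. c) S"
proof -
  have "pderivs js (\<lambda>x. 0) = (\<lambda>x. 0)" for js :: "'n list"
    by (induction js) (auto simp: pderiv_at_const)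
  moreover have "\<exists>c'. pderivs js (\<lambda>x. c) = (\<lambda>x. c')" for js :: "'n list"
    by (induction js) (auto simp: pderiv_at_const)
  then have "pderiv_at i (pderivs js (\<lambda>x. c)) = (\<lambda>x. 0)" for js and i :: 'n
    using pderiv_at_const by metis
  ultimately show ?thesis by (simp add: derivs_commute_on_def pderiv_at_const)
qed

lemma derivs_commute_sum:
  "(\<And>q. q \<in> Q \<Longrightarrow> derivs_commute_on (f q) S \<and> smooth_on (f q) S) \<Longrightarrow>
    derivs_commute_on (\<lambda>x. \<Sum>q\<in>Q. f q x) S"
  by (induction Q rule: infinite_finite_induct)
     (auto simp: derivs_commute_const intro!: derivs_commute_add smooth_sum)

end

subsection \<open>Leading asymptotics at a wall\<close>

locale wall =
  fixes \<alpha> x\<^sub>0 :: "real ^ 'n" and d :: real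
  assumes \<alpha>: "\<alpha> \<noteq> 0" and x\<^sub>0: "\<alpha> \<bullet> x\<^sub>0 = 0" and d: "d > 0"
begin

definition \<Omega> :: "(real ^ 'n) set" where "\<Omega> = ball x\<^sub>0 d \<inter> {x. 0 < \<alpha> \<bullet> x}"

lemma open_\<Omega>: "open \<Omega>"
  by (auto simp: \<Omega>_def open_inner_pos)

sublocale open_domain \<Omega> by unfold_locales (rule open_\<Omega>)

text \<open>The limit runs over the whole half-ball, so bounds along \<open>F\<close> are uniform in
  all directions of approach. This allows points to be moved along slanted lines.\<close>

definition F :: "(real ^ 'n) filter" where "F = at x\<^sub>0 within \<Omega>"

lemma F_nontrivial: "F \<noteq> bot"
proof -
  have "x\<^sub>0 islimpt \<Omega>"
  proof (rule islimpt_approachable[THEN iffD2], intro allI impI)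
    fix e :: real assume e: "e > 0"
    define t where "t = min e d / (2 * norm \<alpha>)"
    have t: "t > 0" "t * norm \<alpha> < e" "t * norm \<alpha> < d" using e d \<alpha> by (auto simp: t_def)
    have "x\<^sub>0 + t *\<^sub>R \<alpha> \<in> \<Omega>" "x\<^sub>0 + t *\<^sub>R \<alpha> \<noteq> x\<^sub>0" "dist (x\<^sub>0 + t *\<^sub>R \<alpha>) x\<^sub>0 < e"
      using t \<alpha> x\<^sub>0 by (auto simp: \<Omega>_def dist_norm inner_add_right)
    then show "\<exists>x'\<in>\<Omega>. x' \<noteq> x\<^sub>0 \<and> dist x' x\<^sub>0 < e" by blast
  qed
  then show ?thesis by (simp add: F_def trivial_limit_within)
qed

lemma eventually_\<Omega>: "eventually (\<lambda>x. x \<in> \<Omega>) F"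
  by (simp add: F_def eventually_at_filter)

lemma tendsto_inner_F: "((\<lambda>x. \<alpha> \<bullet> x) \<longlongrightarrow> 0) F"
proof -
  have "((\<lambda>x. \<alpha> \<bullet> x) \<longlongrightarrow> \<alpha> \<bullet> x\<^sub>0) F"
    unfolding F_def by (intro tendsto_intros)
  then show ?thesis by (simp add: x\<^sub>0)
qed

lemma eventually_F_unit: "eventually (\<lambda>x. x \<in> \<Omega> \<and> 0 < \<alpha> \<bullet> x \<and> \<alpha> \<bullet> x < 1) F"
proof -
  have "eventually (\<lambda>x. \<alpha> \<bullet> x < 1) F"
    by (rule order_tendstoD[OF tendsto_inner_F]) simp
  then show ?thesis using eventually_\<Omega> by eventually_elim (auto simp: \<Omega>_def)
qed

section \<open>Growth orders in terms of \<open>u = \<alpha> \<bullet> x\<close>\<close>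

definition bound :: "real \<Rightarrow> (real ^ 'n \<Rightarrow> complex) \<Rightarrow> bool" where
  "bound r f \<longleftrightarrow> (\<exists>K. eventually (\<lambda>x. norm (f x) \<le> K * (\<alpha> \<bullet> x) powr r) F)"

lemma boundE:
  assumes "bound r f"
  obtains K where "K \<ge> 0" "eventually (\<lambda>x. norm (f x) \<le> K * (\<alpha> \<bullet> x) powr r) F"
proof -
  obtain K where K: "eventually (\<lambda>x. norm (f x) \<le> K * (\<alpha> \<bullet> x) powr r) F"
    using assms by (auto simp: bound_def)
  have "eventually (\<lambda>x. norm (f x) \<le> max K 0 * (\<alpha> \<bullet> x) powr r) F"
    using K
  proof eventually_elim
    case (elim x)
    also have "K * (\<alpha> \<bullet> x) powr r \<le> max K 0 * (\<alpha> \<bullet> x) powr r"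
      by (intro mult_right_mono) auto
    finally show ?case .
  qed
  then show ?thesis by (intro that[of "max K 0"]) auto
qed

lemma bound_add:
  assumes "bound r f" "bound r g"
  shows "bound r (\<lambda>x. f x + g x)"
proof -
  obtain K K' where "eventually (\<lambda>x. norm (f x) \<le> K * (\<alpha> \<bullet> x) powr r) F"
    "eventually (\<lambda>x. norm (g x) \<le> K' * (\<alpha> \<bullet> x) powr r) F"
    using assms by (auto simp: bound_def)
  then have "eventually (\<lambda>x. norm (f x + g x) \<le> (K + K') * (\<alpha> \<bullet> x) powr r) F"
    by eventually_elim (metis add_mono_thms_linordered_semiring(1) distrib_right norm_triangle_le)
  then show ?thesis by (auto simp: bound_def)
qed

lemma bound_mult:
  assumes "bound r f" "bound s g"
  shows "bound (r + s) (\<lambda>x. f x * g x)"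
proof -
  obtain K K' where "K \<ge> 0" "eventually (\<lambda>x. norm (f x) \<le> K * (\<alpha> \<bullet> x) powr r) F"
    "K' \<ge> 0" "eventually (\<lambda>x. norm (g x) \<le> K' * (\<alpha> \<bullet> x) powr s) F"
    using assms by (auto elim!: boundE)
  note * = this
  have "eventually (\<lambda>x. norm (f x * g x) \<le> (K * K') * (\<alpha> \<bullet> x) powr (r + s)) F"
    using *(2,4)
  proof eventually_elim
    case (elim x)
    have "norm (f x * g x) \<le> (K * (\<alpha> \<bullet> x) powr r) * (K' * (\<alpha> \<bullet> x) powr s)"
      unfolding norm_mult using elim *(1,3) by (intro mult_mono) auto
    then show ?case by (simp add: powr_add mult_ac)
  qed
  then show ?thesis by (auto simp: bound_def)
qed

lemma bound_mono:
  assumes "bound r f" "s \<le> r"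
  shows "bound s f"
proof -
  obtain K where K: "K \<ge> 0" "eventually (\<lambda>x. norm (f x) \<le> K * (\<alpha> \<bullet> x) powr r) F"
    using assms(1) by (rule boundE)
  have "eventually (\<lambda>x. norm (f x) \<le> K * (\<alpha> \<bullet> x) powr s) F"
    using K(2) eventually_F_unit
  proof eventually_elim
    case (elim x)
    have "(\<alpha> \<bullet> x) powr r \<le> (\<alpha> \<bullet> x) powr s"
      using elim assms(2) by (intro powr_mono') auto
    then show ?case using elim K(1) by (meson mult_left_mono order_trans)
  qed
  then show ?thesis by (auto simp: bound_def)
qed

lemma bound_cong:
  assumes "\<And>x. x \<in> \<Omega> \<Longrightarrow> f x = g x"
  shows "bound r f \<longleftrightarrow> bound r g"
proof -
  have "eventually (\<lambda>x. norm (f x) \<le> K * (\<alpha> \<bullet> x) powr r) F \<longleftrightarrow>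
      eventually (\<lambda>x. norm (g x) \<le> K * (\<alpha> \<bullet> x) powr r) F" for K
    by (rule eventually_subst) (use eventually_\<Omega> in \<open>auto elim!: eventually_mono simp: assms\<close>)
  then show ?thesis by (simp add: bound_def)
qed

lemma bound_const: "bound 0 (\<lambda>x. c)"
proof -
  have "eventually (\<lambda>x. norm c \<le> norm c * (\<alpha> \<bullet> x) powr 0) F"
    using eventually_F_unit by eventually_elim auto
  then show ?thesis unfolding bound_def by blast
qed

lemma bound_wpow: "bound s (wpow \<alpha> s)"
  unfolding bound_def
  by (rule exI[of _ 1]) (use eventually_F_unit in \<open>auto elim!: eventually_mono simp: wpow_def\<close>)

text \<open>A symbol-type class: each derivative may cost one power of \<open>u\<close>, as it does
  for \<open>u^r\<close> itself. The class is thereby stable under derivatives and products, with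
  orders behaving like exponents.\<close>

definition E :: "real \<Rightarrow> (real ^ 'n \<Rightarrow> complex) \<Rightarrow> bool" where
  "E r f \<longleftrightarrow> smooth_on f \<Omega> \<and> (\<forall>js. bound (r - length js) (pderivs js f))"

lemma E_smooth: "E r f \<Longrightarrow> smooth_on f \<Omega>"
  by (simp add: E_def)

lemma E_cong:
  assumes "\<And>x. x \<in> \<Omega> \<Longrightarrow> f x = g x"
  shows "E r f \<longleftrightarrow> E r g"
  unfolding E_def using smooth_on_cong[OF S assms] bound_cong[OF pderivs_cong[OF S _ assms]] by auto

lemma E_add:
  assumes "E r f" "E r g"
  shows "E r (\<lambda>x. f x + g x)"
  unfolding E_def
proof safe
  fix js
  have "bound (r - length js) (\<lambda>x. pderivs js f x + pderivs js g x)"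
    using assms by (auto simp: E_def intro: bound_add)
  then show "bound (r - length js) (pderivs js (\<lambda>x. f x + g x))"
    by (subst bound_cong[OF pderivs_add]) (use assms E_smooth in auto)
qed (use assms E_smooth smooth_add in auto)

lemma E_mono: "E r f \<Longrightarrow> s \<le> r \<Longrightarrow> E s f"
  unfolding E_def by (meson bound_mono diff_right_mono)

lemma E_pderiv_at: "E r f \<Longrightarrow> E (r - 1) (pderiv_at i f)"
  unfolding E_def
proof safe
  fix js
  assume "\<forall>js. bound (r - real (length js)) (pderivs js f)"
  then have "bound (r - real (length (js @ [i]))) (pderivs (js @ [i]) f)" by blast
  then show "bound (r - 1 - length js) (pderivs js (pderiv_at i f))"
    by (simp add: algebra_simps)
qed (auto intro: smooth_on_pderiv_at)

text \<open>The innermost derivative is split off, since the product rule then leads back to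
  products of functions in such classes, with one of the two orders lowered by 1.\<close>

lemma E_mult:
  assumes "E r f" "E s g"
  shows "E (r + s) (\<lambda>x. f x * g x)"
  unfolding E_def
proof safe
  fix js
  show "bound (r + s - length js) (pderivs js (\<lambda>x. f x * g x))"
    using assms
  proof (induction js arbitrary: r s f g rule: rev_induct)
    case Nil
    then have "bound r f" "bound s g" unfolding E_def by (metis foldr.simps(1) id_apply diff_zero list.size(3) of_nat_0)+
    then show ?case by (simp add: bound_mult)
  next
    case (snoc i js)
    have "bound ((r - 1) + s - length js) (pderivs js (\<lambda>x. pderiv_at i f x * g x))"
      "bound (r + (s - 1) - length js) (pderivs js (\<lambda>x. f x * pderiv_at i g x))"
      using snoc.prems by (auto intro!: snoc.IH E_pderiv_at)
    then have "bound (r + s - length (js @ [i]))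
       (\<lambda>x. pderivs js (\<lambda>x. pderiv_at i f x * g x) x + pderivs js (\<lambda>x. f x * pderiv_at i g x) x)"
      by (intro bound_add) (auto simp: algebra_simps)
    then show ?case
      by (subst bound_cong[OF pderivs_mult_snoc])
         (use snoc.prems E_smooth in \<open>auto intro!: smooth_mult smooth_on_pderiv_at\<close>)
  qed
qed (use assms E_smooth smooth_mult in auto)

lemma \<Omega>_subset: "\<Omega> \<subseteq> {x. \<alpha> \<bullet> x \<noteq> 0}"
  by (auto simp: \<Omega>_def)

lemma smooth_wpow: "smooth_on (wpow \<alpha> s) \<Omega>"
  by (rule smooth_on_subset[OF smooth_on_wpow \<Omega>_subset])

lemma bound_cmult: "bound r f \<Longrightarrow> bound r (\<lambda>x. c * f x)"
  using bound_mult[OF bound_const, of r f c] by simp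

lemma E_cmult: "E r f \<Longrightarrow> E r (\<lambda>x. c * f x)"
  unfolding E_def
proof safe
  fix js assume "smooth_on f \<Omega>" "\<forall>js. bound (r - real (length js)) (pderivs js f)"
  then show "bound (r - real (length js)) (pderivs js (\<lambda>x. c * f x))"
    by (subst bound_cong[OF pderivs_cmult]) (auto intro: bound_cmult)
qed (auto intro: smooth_cmult)

lemma E_wpow: "E s (wpow \<alpha> s)"
  unfolding E_def
proof safe
  fix js
  obtain c where c: "\<And>x. \<alpha> \<bullet> x \<noteq> 0 \<Longrightarrow> pderivs js (wpow \<alpha> s) x = c * wpow \<alpha> (s - length js) x"
    using pderivs_wpow by blast
  then show "bound (s - length js) (pderivs js (wpow \<alpha> s))"
    by (subst bound_cong[OF c]) (use \<Omega>_subset in \<open>auto intro: bound_cmult bound_wpow\<close>)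
qed (rule smooth_wpow)

lemma E_zero: "E r (\<lambda>x. 0)"
  using E_cmult[OF E_wpow, of r 0] by simp

text \<open>All iterated derivatives are continuous at \<open>x\<^sub>0\<close> and hence bounded
  near it, which is stronger than the growth that the class allows.\<close>

lemma E_ball:
  assumes "smooth_on f (ball x\<^sub>0 d)"
  shows "E 0 f"
  unfolding E_def
proof safe
  fix js
  have "continuous_on (ball x\<^sub>0 d) (pderivs js f)"
    using assms by (auto simp: smooth_on_def intro: differentiable_imp_continuous_on)
  then have "isCont (pderivs js f) x\<^sub>0"
    using d by (simp add: continuous_on_eq_continuous_at)
  then have "(pderivs js f \<longlongrightarrow> pderivs js f x\<^sub>0) F"
    unfolding isCont_def F_def by (rule tendsto_mono[rotated]) (simp add: at_le)
  then have "((\<lambda>x. norm (pderivs js f x)) \<longlongrightarrow> norm (pderivs js f x\<^sub>0)) F"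
    by (rule tendsto_norm)
  then have "eventually (\<lambda>x. norm (pderivs js f x) < norm (pderivs js f x\<^sub>0) + 1) F"
    by (rule order_tendstoD) simp
  then have "eventually (\<lambda>x. norm (pderivs js f x) \<le> (norm (pderivs js f x\<^sub>0) + 1) * (\<alpha> \<bullet> x) powr 0) F"
    using eventually_F_unit by eventually_elim auto
  then have "bound 0 (pderivs js f)" unfolding bound_def by blast
  then show "bound (0 - real (length js)) (pderivs js f)" by (rule bound_mono) simp
qed (use assms smooth_on_subset \<Omega>_def in auto)

text \<open>\<open>f\<close> has leading term \<open>c u\<^sup>k\<close> in \<open>u = \<alpha> \<bullet> x\<close>, compatibly with all derivatives. The gain of
  one half in the remainder leaves room for the integration lemma below, which excludes the exponent \<open>0\<close>.\<close>

definition T :: "real \<Rightarrow> complex \<Rightarrow> (real ^ 'n \<Rightarrow> complex) \<Rightarrow> bool" where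
  "T k c f \<longleftrightarrow> E (k + 1/2) (\<lambda>x. f x - c * wpow \<alpha> k x)"

lemma T_smooth: "T k c f \<Longrightarrow> smooth_on f \<Omega>"
  using smooth_add[OF E_smooth smooth_cmult[OF smooth_wpow], of _ "\<lambda>x. f x - c * wpow \<alpha> k x" c k]
  by (simp add: T_def)

lemma T_cong: "(\<And>x. x \<in> \<Omega> \<Longrightarrow> f x = g x) \<Longrightarrow> T k c f \<longleftrightarrow> T k c g"
  unfolding T_def by (rule E_cong) simp

lemma T_add: "T k c f \<Longrightarrow> T k c' g \<Longrightarrow> T k (c + c') (\<lambda>x. f x + g x)"
  unfolding T_def by (drule (1) E_add) (simp add: algebra_simps)

lemma T_cmult: "T k c f \<Longrightarrow> T k (b * c) (\<lambda>x. b * f x)"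
  unfolding T_def by (drule E_cmult[of _ _ b]) (simp add: algebra_simps)

lemma T_zero: "T k 0 (\<lambda>x. 0)"
  by (simp add: T_def E_zero)

lemma T_sum: "(\<And>q. q \<in> Q \<Longrightarrow> T k (c q) (f q)) \<Longrightarrow> T k (\<Sum>q\<in>Q. c q) (\<lambda>x. \<Sum>q\<in>Q. f q x)"
  by (induction Q rule: infinite_finite_induct) (auto simp: T_zero intro!: T_add)

lemma T_wpow: "T k 1 (wpow \<alpha> k)"
  by (simp add: T_def E_zero)

lemma T_imp_E: "T k c f \<Longrightarrow> E k f"
  unfolding T_def
  by (drule E_mono[of _ _ k], simp, drule E_add[OF _ E_cmult[OF E_wpow], of _ _ c]) simp

lemma T_error: "E (k + 1/2) f \<Longrightarrow> T k 0 f"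
  by (simp add: T_def)

lemma T_mult:
  assumes "T k c f" "T l b g"
  shows "T (k + l) (c * b) (\<lambda>x. f x * g x)"
proof -
  have "E (k + (l + 1/2)) (\<lambda>x. (c * wpow \<alpha> k x) * (g x - b * wpow \<alpha> l x))"
    using assms by (intro E_mult E_cmult E_wpow) (simp add: T_def)
  moreover have "E (k + 1/2 + l) (\<lambda>x. (f x - c * wpow \<alpha> k x) * g x)"
    using assms T_imp_E by (intro E_mult) (auto simp: T_def)
  ultimately have "E (k + l + 1/2) (\<lambda>x. (c * wpow \<alpha> k x) * (g x - b * wpow \<alpha> l x) + (f x - c * wpow \<alpha> k x) * g x)"
    by (intro E_add) (simp_all add: algebra_simps)
  then show ?thesis
    unfolding T_def
    by (subst E_cong[of _ "\<lambda>x. (c * wpow \<alpha> k x) * (g x - b * wpow \<alpha> l x) + (f x - c * wpow \<alpha> k x) * g x"])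
       (auto simp: \<Omega>_def wpow_def powr_add algebra_simps)
qed

lemma T_pderiv_at:
  assumes "T k c f"
  shows "T (k - 1) (c * of_real (k * \<alpha> $ i)) (pderiv_at i f)"
proof -
  have "E (k - 1 + 1/2) (pderiv_at i (\<lambda>x. f x - c * wpow \<alpha> k x))"
    using E_pderiv_at assms unfolding T_def by (fastforce simp: algebra_simps)
  moreover have "pderiv_at i (\<lambda>x. f x - c * wpow \<alpha> k x) x
      = pderiv_at i f x - c * of_real (k * \<alpha> $ i) * wpow \<alpha> (k - 1) x" if "x \<in> \<Omega>" for x
    using pderiv_at_add[OF T_smooth[OF assms] smooth_cmult[OF smooth_wpow], of x i "-c" k]
      pderiv_at_cmult_wpow[of \<alpha> x i "-c" k] that \<Omega>_subset by auto
  ultimately show ?thesis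
    unfolding T_def by (subst (asm) E_cong) auto
qed

text \<open>The two orders differ by a factor \<open>sqrt u\<close>, which tends to 0 along the
  non-trivial filter \<open>F\<close>. Leading coefficients are unique for this reason.\<close>

lemma E_tendsto_0:
  assumes "E (k + 1/2) (\<lambda>x. c * wpow \<alpha> k x)"
  shows "c = 0"
proof (rule ccontr)
  assume "c \<noteq> 0"
  have "bound (k + 1/2) (\<lambda>x. c * wpow \<alpha> k x)"
    using assms unfolding E_def by (metis foldr.simps(1) id_apply diff_zero list.size(3) of_nat_0)
  then obtain K where K: "K \<ge> 0" "eventually (\<lambda>x. norm (c * wpow \<alpha> k x) \<le> K * (\<alpha> \<bullet> x) powr (k + 1/2)) F"
    by (rule boundE)
  have "eventually (\<lambda>x. norm c \<le> K * sqrt (\<alpha> \<bullet> x)) F"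
    using K(2) eventually_F_unit
  proof eventually_elim
    case (elim x)
    then have "norm c * (\<alpha> \<bullet> x) powr k \<le> (K * sqrt (\<alpha> \<bullet> x)) * (\<alpha> \<bullet> x) powr k"
      by (simp add: norm_mult wpow_def powr_add powr_half_sqrt mult_ac)
    then show ?case using elim by simp
  qed
  moreover have "((\<lambda>x. K * sqrt (\<alpha> \<bullet> x)) \<longlongrightarrow> K * sqrt 0) F"
    by (intro tendsto_intros tendsto_inner_F)
  ultimately have "norm c \<le> 0"
    using tendsto_lowerbound[of "\<lambda>x. K * sqrt (\<alpha> \<bullet> x)" "K * sqrt 0" F "norm c"] F_nontrivial by simp
  then show False using \<open>c \<noteq> 0\<close> by simp
qed

lemma T_unique:
  assumes "T k c f" "T k b f"
  shows "c = b"
proof -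
  have "E (k + 1/2) (\<lambda>x. (f x - c * wpow \<alpha> k x) + (-1) * (f x - b * wpow \<alpha> k x))"
    using assms unfolding T_def by (intro E_add E_cmult)
  then have "E (k + 1/2) (\<lambda>x. (b - c) * wpow \<alpha> k x)"
    by (simp add: algebra_simps)
  then show ?thesis using E_tendsto_0 by fastforce
qed

end

subsection \<open>Integrating along a line towards the wall\<close>

definition dderiv :: "real ^ 'n \<Rightarrow> (real ^ 'n \<Rightarrow> complex) \<Rightarrow> real ^ 'n \<Rightarrow> complex" where
  "dderiv \<xi> f x = (\<Sum>i\<in>UNIV. of_real (\<xi> $ i) * pderiv_at i f x)"

lemma dderiv_eq:
  assumes "(f has_derivative f') (at x)"
  shows "dderiv \<xi> f x = f' \<xi>"
proof -
  interpret f': bounded_linear f' by (rule has_derivative_bounded_linear[OF assms])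
  have "f' \<xi> = f' (\<Sum>i\<in>UNIV. (\<xi> $ i) *\<^sub>R axis i 1)"
    using basis_expansion[of \<xi>] by (simp add: scalar_mult_eq_scaleR)
  also have "\<dots> = dderiv \<xi> f x"
    by (simp add: dderiv_def pderiv_at_eq[OF assms] f'.sum f'.scaleR scaleR_conv_of_real[where 'a = complex])
  finally show ?thesis by simp
qed

lemma dderiv_line:
  assumes "f differentiable (at (x + t *\<^sub>R \<xi>))"
  shows "((\<lambda>t. f (x + t *\<^sub>R \<xi>)) has_vector_derivative dderiv \<xi> f (x + t *\<^sub>R \<xi>)) (at t)"
proof -
  obtain f' where f': "(f has_derivative f') (at (x + t *\<^sub>R \<xi>))"
    using assms by (auto simp: differentiable_def)
  have "((\<lambda>t. f (x + t *\<^sub>R \<xi>)) has_derivative (\<lambda>h. f' (h *\<^sub>R \<xi>))) (at t)"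
    by (rule has_derivative_compose[of "\<lambda>t. x + t *\<^sub>R \<xi>" "\<lambda>h. h *\<^sub>R \<xi>" t _ f f'])
       (use f' in \<open>auto intro!: derivative_eq_intros\<close>)
  then show ?thesis
    using has_derivative_linear[OF f'] by (simp add: has_vector_derivative_def linear_cmul dderiv_eq[OF f'])
qed

context open_domain
begin

lemma dderiv_cong: "x \<in> S \<Longrightarrow> (\<And>y. y \<in> S \<Longrightarrow> f y = g y) \<Longrightarrow> dderiv \<xi> f x = dderiv \<xi> g x"
  unfolding dderiv_def
  by (rule sum.cong[OF refl]) (simp only: pderiv_at_cong[OF S, of x f g])

lemma dderiv_add:
  "smooth_on f S \<Longrightarrow> smooth_on g S \<Longrightarrow> x \<in> S \<Longrightarrow> dderiv \<xi> (\<lambda>x. f x + g x) x = dderiv \<xi> f x + dderiv \<xi> g x"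
  by (simp add: dderiv_def pderiv_at_add sum.distrib algebra_simps)

lemma dderiv_cmult:
  "smooth_on f S \<Longrightarrow> x \<in> S \<Longrightarrow> dderiv \<xi> (\<lambda>x. c * f x) x = c * dderiv \<xi> f x"
  by (simp add: dderiv_def pderiv_at_cmult sum_distrib_left mult_ac)

lemma pderivs_sum:
  "(\<And>q. q \<in> Q \<Longrightarrow> smooth_on (f q) S) \<Longrightarrow> x \<in> S \<Longrightarrow>
   pderivs js (\<lambda>x. \<Sum>q\<in>Q. f q x) x = (\<Sum>q\<in>Q. pderivs js (f q) x)"
proof (induction Q rule: infinite_finite_induct)
  case empty
  then show ?case using pderivs_cmult[OF smooth_const, of x js 0 1] by simp
next
  case (infinite Q)
  then show ?case using pderivs_cmult[OF smooth_const, of x js 0 1] by simp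
qed (auto simp: pderivs_add smooth_sum)

lemma pderivs_dderiv:
  assumes "smooth_on g S" "derivs_commute_on g S" "x \<in> S"
  shows "pderivs js (dderiv \<xi> g) x = dderiv \<xi> (pderivs js g) x"
proof -
  have "pderivs js (dderiv \<xi> g) x = (\<Sum>i\<in>UNIV. pderivs js (\<lambda>x. of_real (\<xi> $ i) * pderiv_at i g x) x)"
    unfolding dderiv_def[abs_def] using assms by (intro pderivs_sum smooth_cmult smooth_on_pderiv_at)
  then show ?thesis
    using assms by (simp add: pderivs_cmult smooth_on_pderiv_at dderiv_def derivs_commute_on_def)
qed

end

context wall
begin

text \<open>A point is carried away from the wall for the fixed time \<open>t\<^sub>0\<close>. The
  end value stays bounded because \<open>g\<close> is continuous at the interior point
  \<open>y\<close>, and integrating the bound on the derivative costs a multiple of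
  \<open>u powr r\<close>. As \<open>r < 0\<close>, the bounded end value is of that order
  too.\<close>

lemma bound_integrate_pos:
  assumes g: "\<And>x. x \<in> \<Omega> \<Longrightarrow> g differentiable (at x)"
    and pos: "\<alpha> \<bullet> \<xi> > 0" and r: "r < 0" and b: "bound (r - 1) (dderiv \<xi> g)"
  shows "bound r g"
proof -
  define v where "v = \<alpha> \<bullet> \<xi>"
  have v: "v > 0" using pos by (simp add: v_def)
  obtain K where K: "K \<ge> 0" "eventually (\<lambda>x. norm (dderiv \<xi> g x) \<le> K * (\<alpha> \<bullet> x) powr (r - 1)) F"
    using b by (rule boundE)
  obtain \<delta>' where \<delta>': "\<delta>' > 0" "\<And>x. x \<in> \<Omega> \<Longrightarrow> x \<noteq> x\<^sub>0 \<Longrightarrow> dist x x\<^sub>0 < \<delta>' \<Longrightarrow>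
      norm (dderiv \<xi> g x) \<le> K * (\<alpha> \<bullet> x) powr (r - 1)"
    using K(2) unfolding F_def eventually_at by blast
  define \<delta> where "\<delta> = min \<delta>' d"
  have \<delta>: "\<delta> > 0" using \<delta>' d by (simp add: \<delta>_def)
  \<comment> \<open>Half of the radius is reserved for the starting point and half for the
    displacement; the added 1 makes the latter strictly shorter.\<close>
  define t\<^sub>0 where "t\<^sub>0 = \<delta> / (2 * (norm \<xi> + 1))"
  have t\<^sub>0: "t\<^sub>0 > 0" unfolding t\<^sub>0_def using \<delta> by (simp add: add_nonneg_pos)
  have t\<^sub>0': "t\<^sub>0 * norm \<xi> < \<delta> / 2"
  proof -
    have "norm \<xi> + 1 > 0" using norm_ge_zero[of \<xi>] by linarith
    then have "norm \<xi> / (norm \<xi> + 1) < 1" by simp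
    then have "\<delta> / 2 * (norm \<xi> / (norm \<xi> + 1)) < \<delta> / 2 * 1" using \<delta> by (intro mult_strict_left_mono) auto
    then show ?thesis by (simp add: t\<^sub>0_def)
  qed
  have path: "x + t *\<^sub>R \<xi> \<in> \<Omega>" "dist (x + t *\<^sub>R \<xi>) x\<^sub>0 < \<delta>'" "\<alpha> \<bullet> (x + t *\<^sub>R \<xi>) = \<alpha> \<bullet> x + t * v"
    if "dist x x\<^sub>0 < \<delta> / 2" "0 \<le> \<alpha> \<bullet> x" "0 < \<alpha> \<bullet> x \<or> 0 < t" "0 \<le> t" "t \<le> t\<^sub>0" for x t
  proof -
    have "dist (x + t *\<^sub>R \<xi>) x\<^sub>0 \<le> dist x x\<^sub>0 + t * norm \<xi>"
      using norm_triangle_ineq[of "x - x\<^sub>0" "t *\<^sub>R \<xi>"] that(4) by (simp add: dist_norm algebra_simps)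
    also have "t * norm \<xi> \<le> t\<^sub>0 * norm \<xi>" using that by (intro mult_right_mono) auto
    finally have "dist (x + t *\<^sub>R \<xi>) x\<^sub>0 < \<delta>" using that(1) t\<^sub>0' by linarith
    moreover show e: "\<alpha> \<bullet> (x + t *\<^sub>R \<xi>) = \<alpha> \<bullet> x + t * v" by (simp add: inner_add_right v_def)
    moreover have "\<alpha> \<bullet> x + t * v > 0" using that v mult_nonneg_nonneg[of t v] mult_pos_pos[of t v] by linarith
    ultimately show "x + t *\<^sub>R \<xi> \<in> \<Omega>" "dist (x + t *\<^sub>R \<xi>) x\<^sub>0 < \<delta>'"
      by (auto simp: \<Omega>_def \<delta>_def dist_commute)
  qed
  define y where "y = x\<^sub>0 + t\<^sub>0 *\<^sub>R \<xi>"
  have "y \<in> \<Omega>" using path(1)[of x\<^sub>0 t\<^sub>0] \<delta> t\<^sub>0 by (simp add: y_def x\<^sub>0)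
  then have "isCont g y" using g differentiable_imp_continuous_within by blast
  moreover have "((\<lambda>x. x + t\<^sub>0 *\<^sub>R \<xi>) \<longlongrightarrow> y) F"
    unfolding y_def F_def by (intro tendsto_intros)
  ultimately have "((\<lambda>x. norm (g (x + t\<^sub>0 *\<^sub>R \<xi>))) \<longlongrightarrow> norm (g y)) F"
    by (rule tendsto_norm[OF isCont_tendsto_compose])
  then have "eventually (\<lambda>x. norm (g (x + t\<^sub>0 *\<^sub>R \<xi>)) < norm (g y) + 1) F"
    by (rule order_tendstoD) simp
  moreover have "eventually (\<lambda>x. dist x x\<^sub>0 < \<delta> / 2) F"
    unfolding F_def eventually_at using \<delta> by (intro exI[of _ "\<delta> / 2"]) auto
  ultimately have "eventually (\<lambda>x. norm (g x) \<le> (norm (g y) + 1 + K / (- r * v)) * (\<alpha> \<bullet> x) powr r) F"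
    using eventually_F_unit
  proof eventually_elim
    case (elim x)
    define \<psi> where "\<psi> t = K / (r * v) * (\<alpha> \<bullet> x + t * v) powr r" for t
    have u: "\<alpha> \<bullet> x + t * v > 0" if "0 \<le> t" for t
      using elim v that by (simp add: add_pos_nonneg)
    have \<psi>': "(\<psi> has_vector_derivative K * (\<alpha> \<bullet> x + t * v) powr (r - 1)) (at t)" if "0 \<le> t" for t
    proof -
      have "((\<lambda>t. (\<alpha> \<bullet> x + t * v) powr r) has_real_derivative
          r * (\<alpha> \<bullet> x + t * v) powr (r - of_nat 1) * v) (at t)"
        by (rule DERIV_fun_powr) (use u[OF that] in \<open>auto intro!: derivative_eq_intros\<close>)
      from DERIV_cmult[OF this, of "K / (r * v)"] show ?thesis
        unfolding has_real_derivative_iff_has_vector_derivative[symmetric] \<psi>_def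
        using r v by (simp add: mult_ac)
    qed
    have g': "((\<lambda>t. g (x + t *\<^sub>R \<xi>)) has_vector_derivative dderiv \<xi> g (x + t *\<^sub>R \<xi>)) (at t)"
      if "0 \<le> t" "t \<le> t\<^sub>0" for t
      by (rule dderiv_line, rule g, rule path(1)) (use that elim in auto)
    have "norm (g (x + t\<^sub>0 *\<^sub>R \<xi>) - g (x + 0 *\<^sub>R \<xi>)) \<le> \<psi> t\<^sub>0 - \<psi> 0"
    proof (rule differentiable_bound_general[OF t\<^sub>0, where f = "\<lambda>t. g (x + t *\<^sub>R \<xi>)"])
      show "continuous_on {0..t\<^sub>0} (\<lambda>t. g (x + t *\<^sub>R \<xi>))"
        by (rule continuous_on_vector_derivative[where f' = "\<lambda>t. dderiv \<xi> g (x + t *\<^sub>R \<xi>)"])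
           (use g' in \<open>auto intro: has_vector_derivative_at_within\<close>)
      show "continuous_on {0..t\<^sub>0} \<psi>"
        by (rule continuous_on_vector_derivative[where f' = "\<lambda>t. K * (\<alpha> \<bullet> x + t * v) powr (r - 1)"])
           (use \<psi>' in \<open>auto intro: has_vector_derivative_at_within\<close>)
      fix t assume t: "0 < t" "t < t\<^sub>0"
      show "((\<lambda>t. g (x + t *\<^sub>R \<xi>)) has_vector_derivative dderiv \<xi> g (x + t *\<^sub>R \<xi>)) (at t)" using g' t by simp
      show "(\<psi> has_vector_derivative K * (\<alpha> \<bullet> x + t * v) powr (r - 1)) (at t)" using \<psi>' t by simp
      have "x + t *\<^sub>R \<xi> \<noteq> x\<^sub>0" using path(3)[of x t] u[of t] t elim x\<^sub>0 by auto
      then show "norm (dderiv \<xi> g (x + t *\<^sub>R \<xi>)) \<le> K * (\<alpha> \<bullet> x + t * v) powr (r - 1)"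
        using \<delta>'(2)[of "x + t *\<^sub>R \<xi>"] path[of x t] elim t by auto
    qed
    also have "\<psi> t\<^sub>0 \<le> 0"
    proof -
      have "K / (r * v) \<le> 0" using K(1) r v by (simp add: divide_nonneg_nonpos mult_nonpos_nonneg)
      then show ?thesis unfolding \<psi>_def by (rule mult_nonpos_nonneg) simp
    qed
    also have "0 - \<psi> 0 = K / (- r * v) * (\<alpha> \<bullet> x) powr r" by (simp add: \<psi>_def)
    finally have "norm (g (x + t\<^sub>0 *\<^sub>R \<xi>) - g x) \<le> K / (- r * v) * (\<alpha> \<bullet> x) powr r" by simp
    then have "norm (g x) \<le> norm (g y) + 1 + K / (- r * v) * (\<alpha> \<bullet> x) powr r"
      using norm_triangle_ineq3[of "g (x + t\<^sub>0 *\<^sub>R \<xi>)" "g x"] elim by linarith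
    also have "norm (g y) + 1 \<le> (norm (g y) + 1) * (\<alpha> \<bullet> x) powr r"
    proof -
      have "(\<alpha> \<bullet> x) powr 0 \<le> (\<alpha> \<bullet> x) powr r"
        using elim r by (intro powr_mono') auto
      then have "(norm (g y) + 1) * 1 \<le> (norm (g y) + 1) * (\<alpha> \<bullet> x) powr r"
        using elim by (intro mult_left_mono) auto
      then show ?thesis by simp
    qed
    finally show ?case by (simp add: algebra_simps)
  qed
  then show ?thesis unfolding bound_def by blast
qed

lemma bound_integrate:
  assumes g: "\<And>x. x \<in> \<Omega> \<Longrightarrow> g differentiable (at x)"
    and "\<alpha> \<bullet> \<xi> \<noteq> 0" and r: "r < 0" and b: "bound (r - 1) (dderiv \<xi> g)"
  shows "bound r g"
proof (cases "\<alpha> \<bullet> \<xi> > 0")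
  case True
  then show ?thesis using assms bound_integrate_pos by blast
next
  case False
  have "dderiv (-\<xi>) g = (\<lambda>x. (-1) * dderiv \<xi> g x)" by (auto simp: dderiv_def sum_negf)
  then have "bound (r - 1) (dderiv (-\<xi>) g)" using bound_cmult[OF b, of "-1"] by simp
  then show ?thesis using False assms by (intro bound_integrate_pos[of g "-\<xi>"]) auto
qed

lemma E_integrate:
  assumes "smooth_on g \<Omega>" "derivs_commute_on g \<Omega>" "\<alpha> \<bullet> \<xi> \<noteq> 0" "r < 0" "E (r - 1) (dderiv \<xi> g)"
  shows "E r g"
  unfolding E_def
proof safe
  fix js
  have "bound (r - 1 - length js) (pderivs js (dderiv \<xi> g))"
    using assms(5) by (simp add: E_def)
  then have "bound (r - length js - 1) (dderiv \<xi> (pderivs js g))"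
    by (subst (asm) bound_cong[OF pderivs_dderiv]) (use assms in \<open>auto simp: algebra_simps\<close>)
  then show "bound (r - length js) (pderivs js g)"
    using assms by (intro bound_integrate[of "pderivs js g" \<xi>]) (auto intro: smooth_differentiable smooth_on_pderivs)
qed fact

text \<open>The explicit antiderivative \<open>c' * u^k\<close> of the leading term is subtracted,
  and \<open>E_integrate\<close> treats the rest at order \<open>k + 1/2\<close>. The bound
  \<open>k < -1/2\<close> says that this order is negative, which is what absorbs the constant of
  integration.\<close>

lemma T_integrate:
  assumes "smooth_on g \<Omega>" "derivs_commute_on g \<Omega>" "\<alpha> \<bullet> \<xi> \<noteq> 0" "k < -1/2" "T (k - 1) c (dderiv \<xi> g)"
  obtains c' where "T k c' g"
proof -
  define c' where "c' = c / of_real (k * (\<alpha> \<bullet> \<xi>))"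
  define h where "h = (\<lambda>x. g x + (- c') * wpow \<alpha> k x)"
  have h: "smooth_on h \<Omega>" unfolding h_def using assms by (intro smooth_add smooth_cmult smooth_wpow)
  have "derivs_commute_on h \<Omega>"
    unfolding h_def using assms
    by (intro derivs_commute_add derivs_commute_cmult smooth_cmult smooth_wpow
        derivs_commute_on_subset[OF derivs_commute_wpow \<Omega>_subset])
  moreover have "E (k + 1/2 - 1) (dderiv \<xi> h)"
  proof -
    have "dderiv \<xi> h x = dderiv \<xi> g x - c * wpow \<alpha> (k - 1) x" if "x \<in> \<Omega>" for x
    proof -
      have "dderiv \<xi> (wpow \<alpha> k) x = of_real (k * (\<alpha> \<bullet> \<xi>)) * wpow \<alpha> (k - 1) x"
        using that \<Omega>_subset by (intro dderiv_eq wpow_has_derivative) auto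
      then show ?thesis
        using that assms unfolding h_def
        by (simp only: dderiv_add dderiv_cmult smooth_cmult smooth_wpow) (simp add: c'_def)
    qed
    then show ?thesis
      using assms(5) by (subst E_cong) (auto simp: T_def algebra_simps)
  qed
  ultimately have "E (k + 1/2) h" using assms by (intro E_integrate[OF h]) auto
  then have "T k c' g" by (simp add: T_def h_def)
  then show thesis by (rule that)
qed

end

subsection \<open>Extracting the coefficients of a symbol\<close>

text \<open>Finitely many hyperplanes do not fill the space. Moving along \<beta> repairs the new
  condition; vectors orthogonal to \<beta> are unaffected, and every other one rules out a single
  parameter value.\<close>

lemma ex_inner_nonzero:
  fixes B :: "(real ^ 'n) set"
  assumes "finite B" "0 \<notin> B"
  shows "\<exists>x. \<forall>\<beta>\<in>B. \<beta> \<bullet> x \<noteq> 0"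
  using assms
proof (induction B)
  case (insert \<beta> B)
  then obtain x where x: "\<forall>\<gamma>\<in>B. \<gamma> \<bullet> x \<noteq> 0" by auto
  have "finite ((\<lambda>\<gamma>. - (\<gamma> \<bullet> x) / (\<gamma> \<bullet> \<beta>)) ` (insert \<beta> B) \<union> {0})" using insert by simp
  then obtain t where t: "t \<notin> (\<lambda>\<gamma>. - (\<gamma> \<bullet> x) / (\<gamma> \<bullet> \<beta>)) ` (insert \<beta> B) \<union> {0}"
    using ex_new_if_finite infinite_UNIV_char_0 by blast
  have "\<gamma> \<bullet> (x + t *\<^sub>R \<beta>) \<noteq> 0" if "\<gamma> \<in> insert \<beta> B" for \<gamma>
  proof (cases "\<gamma> \<bullet> \<beta> = 0")
    case True
    then show ?thesis using that x insert.prems by (auto simp: inner_add_right)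
  next
    case False
    then have "t \<noteq> - (\<gamma> \<bullet> x) / (\<gamma> \<bullet> \<beta>)" using t that by auto
    then show ?thesis using False by (auto simp: inner_add_right field_simps)
  qed
  then show ?case by blast
qed auto

text \<open>Gaussian elimination on a Vandermonde system modulo the subspace \<open>V\<close>: row
  \<open>s + 1\<close> minus \<open>\<mu> q\<^sub>0\<close> times row \<open>s\<close> removes
  \<open>b q\<^sub>0\<close> and leaves a system of the same form for the multiples
  \<open>(\<mu> q - \<mu> q\<^sub>0) * b q\<close>.\<close>

lemma vandermonde_extract:
  fixes b :: "'q \<Rightarrow> 'x \<Rightarrow> complex" and \<mu> :: "'q \<Rightarrow> complex"
  assumes add: "\<And>f g. f \<in> V \<Longrightarrow> g \<in> V \<Longrightarrow> (\<lambda>x. f x + g x) \<in> V"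
    and cmult: "\<And>c f. f \<in> V \<Longrightarrow> (\<lambda>x. c * f x) \<in> V"
    and zero: "(\<lambda>x. 0) \<in> V"
    and "finite Q" "inj_on \<mu> Q"
    and "\<And>s. s < card Q \<Longrightarrow> (\<lambda>x. \<Sum>q\<in>Q. \<mu> q ^ s * b q x) \<in> V"
  shows "\<forall>q\<in>Q. b q \<in> V"
  using assms(4-)
proof (induction Q arbitrary: b)
  case (insert q\<^sub>0 Q)
  have "\<forall>q\<in>Q. (\<lambda>x. (\<mu> q - \<mu> q\<^sub>0) * b q x) \<in> V"
  proof (rule insert.IH)
    fix s assume s: "s < card Q"
    then have "Suc s < card (insert q\<^sub>0 Q)" "s < card (insert q\<^sub>0 Q)" using insert.hyps by auto
    then have "(\<lambda>x. (\<Sum>q\<in>insert q\<^sub>0 Q. \<mu> q ^ Suc s * b q x) + (- \<mu> q\<^sub>0) * (\<Sum>q\<in>insert q\<^sub>0 Q. \<mu> q ^ s * b q x)) \<in> V"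
      by (intro add cmult insert.prems(2))
    also have "(\<lambda>x. (\<Sum>q\<in>insert q\<^sub>0 Q. \<mu> q ^ Suc s * b q x) + (- \<mu> q\<^sub>0) * (\<Sum>q\<in>insert q\<^sub>0 Q. \<mu> q ^ s * b q x))
        = (\<lambda>x. \<Sum>q\<in>Q. \<mu> q ^ s * ((\<mu> q - \<mu> q\<^sub>0) * b q x))"
      using insert.hyps by (auto simp: sum_distrib_left algebra_simps sum_subtractf sum_negf)
    finally show "(\<lambda>x. \<Sum>q\<in>Q. \<mu> q ^ s * ((\<mu> q - \<mu> q\<^sub>0) * b q x)) \<in> V" .
  qed (use insert.prems in auto)
  then have Q: "b q \<in> V" if "q \<in> Q" for q
  proof -
    have "\<mu> q \<noteq> \<mu> q\<^sub>0" using insert.hyps insert.prems that by (auto simp: inj_on_def)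
    then show ?thesis
      using cmult[of "\<lambda>x. (\<mu> q - \<mu> q\<^sub>0) * b q x" "inverse (\<mu> q - \<mu> q\<^sub>0)"]
        \<open>\<forall>q\<in>Q. (\<lambda>x. (\<mu> q - \<mu> q\<^sub>0) * b q x) \<in> V\<close> that by (simp add: mult.assoc[symmetric])
  qed
  have "(\<lambda>x. \<Sum>q\<in>Q'. b q x) \<in> V" if "Q' \<subseteq> Q" for Q'
    using finite_subset[OF that insert.hyps(1)] that
    by (induction Q') (use Q zero add in auto)
  then have "(\<lambda>x. (\<Sum>q\<in>insert q\<^sub>0 Q. \<mu> q ^ 0 * b q x) + (-1) * (\<Sum>q\<in>Q. b q x)) \<in> V"
    using insert.hyps by (intro add cmult insert.prems(2)) auto
  then have "b q\<^sub>0 \<in> V" using insert.hyps by simp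
  then show ?case using Q by auto
qed auto

lemma finite_mi_size_eq: "finite {p :: 'n::finite \<Rightarrow> nat. mi_size p = m}"
  by (rule finite_subset[OF _ finite_mi_size_le[of m]]) auto

text \<open>Integration towards the wall controls whole symbols, and only in directions \<xi>
  transversal to it. Rescaling the coordinates of one generic vector by exponentials multiplies its
  monomials by powers of distinct numbers, so single coefficients follow from a Vandermonde
  system.\<close>

lemma symbol_extract:
  fixes a :: "('n::finite \<Rightarrow> nat) \<Rightarrow> 'x \<Rightarrow> complex"
  assumes add: "\<And>f g. f \<in> V \<Longrightarrow> g \<in> V \<Longrightarrow> (\<lambda>x. f x + g x) \<in> V"
    and cmult: "\<And>c f. f \<in> V \<Longrightarrow> (\<lambda>x. c * f x) \<in> V"
    and zero: "(\<lambda>x. 0) \<in> V"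
    and \<alpha>: "\<alpha> \<noteq> 0"
    and V: "\<And>\<xi>. \<alpha> \<bullet> \<xi> \<noteq> 0 \<Longrightarrow> (\<lambda>x. \<Sum>q | mi_size q = m. a q x * of_real (mi_power \<xi> q)) \<in> V"
    and q: "mi_size q = m"
  shows "a q \<in> V"
proof -
  define Q where "Q = {q :: 'n \<Rightarrow> nat. mi_size q = m}"
  have Q: "finite Q" unfolding Q_def by (rule finite_mi_size_eq)
  define vec where "vec q = (\<chi> i. real (q i))" for q :: "'n \<Rightarrow> nat"
  have vec: "q = q'" if "vec q = vec q'" for q q'
    using that by (auto simp: vec_def vec_eq_iff fun_eq_iff)
  \<comment> \<open>A weight vector \<open>w\<close> that separates the finitely many exponents in
    \<open>Q\<close>; the nodes \<open>exp (vec q \<bullet> w)\<close> are then distinct.\<close>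
  have "\<exists>w. \<forall>\<beta>\<in>(\<lambda>(q,q'). vec q - vec q') ` (Q \<times> Q) - {0}. \<beta> \<bullet> w \<noteq> 0"
    using Q by (intro ex_inner_nonzero) auto
  then obtain w where w': "\<And>\<beta>. \<beta> \<in> (\<lambda>(q,q'). vec q - vec q') ` (Q \<times> Q) - {0} \<Longrightarrow> \<beta> \<bullet> w \<noteq> 0"
    by blast
  have w: "vec q \<bullet> w \<noteq> vec q' \<bullet> w" if "q \<in> Q" "q' \<in> Q" "q \<noteq> q'" for q q'
  proof -
    have "vec q - vec q' \<in> (\<lambda>(q,q'). vec q - vec q') ` (Q \<times> Q) - {0}"
      using that vec[of q q'] by (auto intro!: image_eqI[of _ _ "(q, q')"])
    from w'[OF this] show ?thesis by (simp add: inner_diff_left)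
  qed
  \<comment> \<open>The scaling is moved from \<xi> to \<alpha>: transversality of the scaled
    direction becomes \<open>\<alpha>s s \<bullet> \<eta> \<noteq> 0\<close>, so one generic \<eta>
    serves all rows. Avoiding the coordinate hyperplanes as well lets the monomials of \<eta> be
    divided out at the end.\<close>
  define \<alpha>s where "\<alpha>s s = (\<chi> i. exp (real s * w $ i) * \<alpha> $ i)" for s :: nat
  have \<alpha>s: "\<alpha>s s \<noteq> 0" for s
    using \<alpha> by (auto simp: \<alpha>s_def vec_eq_iff)
  have "\<exists>\<eta>. \<forall>\<beta>\<in>\<alpha>s ` {..<card Q} \<union> range (\<lambda>i. axis i 1). \<beta> \<bullet> \<eta> \<noteq> 0"
    using \<alpha>s by (intro ex_inner_nonzero) (auto simp: axis_eq_0_iff)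
  then obtain \<eta> where \<eta>: "\<And>s. s < card Q \<Longrightarrow> \<alpha>s s \<bullet> \<eta> \<noteq> 0" "\<And>i. \<eta> $ i \<noteq> 0"
    by (auto simp: inner_axis' ball_Un)
  define \<mu> :: "('n \<Rightarrow> nat) \<Rightarrow> complex" where "\<mu> q = of_real (exp (vec q \<bullet> w))" for q
  define b where "b q x = of_real (mi_power \<eta> q) * a q x" for q x
  have "\<forall>q\<in>Q. b q \<in> V"
  proof (rule vandermonde_extract)
    show "(\<lambda>x. f x + g x) \<in> V" if "f \<in> V" "g \<in> V" for f g using that by (rule add)
    show "(\<lambda>x. c * f x) \<in> V" if "f \<in> V" for c f using that by (rule cmult)
    show "(\<lambda>x. 0) \<in> V" "finite Q" by fact+
    show "inj_on \<mu> Q" using w by (auto simp: inj_on_def \<mu>_def)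
    fix s assume s: "s < card Q"
    define \<xi> where "\<xi> = (\<chi> i. exp (real s * w $ i) * \<eta> $ i)"
    have "\<alpha> \<bullet> \<xi> = \<alpha>s s \<bullet> \<eta>" by (simp add: \<alpha>s_def \<xi>_def inner_vec_def mult_ac)
    then have "(\<lambda>x. \<Sum>q | mi_size q = m. a q x * of_real (mi_power \<xi> q)) \<in> V"
      using V \<eta> s by auto
    moreover have "mi_power \<xi> q = exp (vec q \<bullet> w) ^ s * mi_power \<eta> q" for q
    proof -
      have "exp (real s * w $ i) ^ q i = exp (real (q i) * w $ i) ^ s" for i
        by (simp only: exp_of_nat_mult[symmetric]) (simp add: mult_ac)
      then have "mi_power \<xi> q = (\<Prod>i\<in>UNIV. exp (real (q i) * w $ i) ^ s) * mi_power \<eta> q"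
        by (simp add: mi_power_def \<xi>_def power_mult_distrib prod.distrib)
      also have "(\<Prod>i\<in>UNIV. exp (real (q i) * w $ i) ^ s) = exp (vec q \<bullet> w) ^ s"
        by (simp add: inner_vec_def vec_def exp_sum prod_power_distrib)
      finally show ?thesis .
    qed
    ultimately show "(\<lambda>x. \<Sum>q\<in>Q. \<mu> q ^ s * b q x) \<in> V"
      by (simp add: Q_def \<mu>_def b_def mult_ac)
  qed
  then have "b q \<in> V" using q by (simp add: Q_def)
  then have "(\<lambda>x. inverse (of_real (mi_power \<eta> q)) * b q x) \<in> V"
    by (rule cmult)
  moreover have "mi_power \<eta> q \<noteq> 0" using \<eta>(2) by (simp add: mi_power_def)
  ultimately show ?thesis by (simp add: b_def mult.assoc[symmetric])
qed

subsection \<open>Conjugation of differential operators by exponentials\<close>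

definition mi_word :: "('n::finite \<Rightarrow> nat) \<Rightarrow> 'n list" where
  "mi_word p = concat (map (\<lambda>i. replicate (p i) i) index_list)"

lemma mi_deriv_eq_pderivs: "mi_deriv p f = pderivs (mi_word p) f"
proof -
  have "foldr (\<lambda>i. pderiv_at i ^^ p i) xs f = foldr pderiv_at (concat (map (\<lambda>i. replicate (p i) i) xs)) f" for xs
    by (induction xs) (auto simp: foldr_replicate)
  then show ?thesis by (simp add: mi_deriv_def mi_word_def)
qed

lemma length_mi_word: "length (mi_word (p :: 'n::finite \<Rightarrow> nat)) = mi_size p"
  using index_list[where 'n = 'n]
  by (simp add: mi_word_def length_concat o_def mi_size_def sum_list_distinct_conv_sum_set)

lemma prod_list_mi_word:
  fixes f :: "'n::finite \<Rightarrow> 'b::comm_monoid_mult"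
  shows "prod_list (map f (mi_word p)) = (\<Prod>i\<in>UNIV. f i ^ p i)"
proof -
  have "prod_list (map f (concat (map (\<lambda>i. replicate (p i) i) xs))) = prod_list (map (\<lambda>i. f i ^ p i) xs)" for xs
    by (induction xs) (auto simp: prod_list_replicate)
  then show ?thesis
    using prod.distinct_set_conv_list[OF index_list(1)[where 'n = 'n], of "\<lambda>i. f i ^ p i"]
    by (simp add: mi_word_def index_list(2))
qed

text \<open>\<open>conj_word \<xi> js n f\<close> is the coefficient of \<open>\<tau>\<^sup>n\<close> in \<open>\<Prod> (\<partial>\<^sub>j + \<tau> \<xi>\<^sub>j) f\<close>, the product
  running over \<open>js\<close>.\<close>

primrec conj_word ::
  "real ^ 'n \<Rightarrow> 'n list \<Rightarrow> nat \<Rightarrow> (real ^ 'n \<Rightarrow> complex) \<Rightarrow> real ^ 'n \<Rightarrow> complex" where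
  "conj_word \<xi> [] n f = (if n = 0 then f else (\<lambda>x. 0))"
| "conj_word \<xi> (i # js) n f = (\<lambda>x. pderiv_at i (conj_word \<xi> js n f) x +
     of_real (\<xi> $ i) * (case n of 0 \<Rightarrow> 0 | Suc k \<Rightarrow> conj_word \<xi> js k f x))"

text \<open>The coefficient of \<open>\<tau>^n\<close> in \<open>P\<close> conjugated by the
  exponential of \<open>\<tau> * (\<xi> \<bullet> x)\<close>.\<close>

definition conj_op ::
  "nat \<Rightarrow> (('n \<Rightarrow> nat) \<Rightarrow> real ^ 'n \<Rightarrow> complex) \<Rightarrow> real ^ 'n \<Rightarrow> nat \<Rightarrow>
   (real ^ 'n \<Rightarrow> complex) \<Rightarrow> real ^ 'n \<Rightarrow> complex" where
  "conj_op m a \<xi> n f x = (\<Sum>q | mi_size q \<le> m. a q x * conj_word \<xi> (mi_word q) n f x)"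

lemma real_polynomial_coeffs_zero:
  fixes c :: "nat \<Rightarrow> complex"
  assumes "\<And>\<tau>::real. (\<Sum>n\<le>N. c n * of_real \<tau> ^ n) = 0" "n \<le> N"
  shows "c n = 0"
proof (rule ccontr)
  assume "c n \<noteq> 0"
  then have "finite {z. (\<Sum>n\<le>N. c n * z ^ n) = 0}"
    using polyfun_finite_roots[of c N] assms(2) by blast
  moreover have "range complex_of_real \<subseteq> {z. (\<Sum>n\<le>N. c n * z ^ n) = 0}" using assms(1) by auto
  ultimately have "finite (range complex_of_real)" by (rule rev_finite_subset)
  then show False
    using finite_imageD[of complex_of_real UNIV] infinite_UNIV_char_0 by (auto simp: inj_def)
qed

context open_domain
begin

lemma conj_word_zero: "length js < n \<Longrightarrow> conj_word \<xi> js n f = (\<lambda>x. 0)"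
  by (induction js arbitrary: n) (auto simp: pderiv_at_const split: nat.split)

lemma smooth_conj_word: "smooth_on f S \<Longrightarrow> smooth_on (conj_word \<xi> js n f) S"
proof (induction js arbitrary: n)
  case (Cons i js)
  have "smooth_on (\<lambda>x. case n of 0 \<Rightarrow> 0 | Suc k \<Rightarrow> conj_word \<xi> js k f x) S"
    using Cons by (cases n) (auto intro: smooth_const)
  then show ?case
    using Cons by (auto intro!: smooth_add smooth_cmult smooth_on_pderiv_at)
qed (auto intro: smooth_const)

lemma smooth_conj_op:
  "(\<And>q. mi_size q \<le> m \<Longrightarrow> smooth_on (a q) S) \<Longrightarrow> smooth_on f S \<Longrightarrow> smooth_on (conj_op m a \<xi> n f) S"
  unfolding conj_op_def[abs_def] by (intro smooth_sum smooth_mult smooth_conj_word) auto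

lemma conj_word_cong:
  "x \<in> S \<Longrightarrow> (\<And>y. y \<in> S \<Longrightarrow> f y = g y) \<Longrightarrow> conj_word \<xi> js n f x = conj_word \<xi> js n g x"
proof (induction js arbitrary: n x)
  case (Cons i js)
  have "pderiv_at i (conj_word \<xi> js n f) x = pderiv_at i (conj_word \<xi> js n g) x"
    using Cons by (intro pderiv_at_cong[OF S]) auto
  then show ?case using Cons by (auto split: nat.split)
qed auto

lemma pderivs_mult_expw:
  assumes f: "smooth_on f S" and "x \<in> S" "length js \<le> N"
  shows "pderivs js (\<lambda>x. f x * expw (\<tau> *\<^sub>R \<xi>) x) x
    = (\<Sum>n\<le>N. of_real \<tau> ^ n * conj_word \<xi> js n f x) * expw (\<tau> *\<^sub>R \<xi>) x"
  using assms(2-)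
proof (induction js arbitrary: x)
  case Nil
  have "(\<Sum>n\<le>N. of_real \<tau> ^ n * (if n = 0 then f else (\<lambda>x. 0)) x) = (\<Sum>n\<in>{0}. of_real \<tau> ^ n * f x)"
    by (rule sum.mono_neutral_cong_right) auto
  then show ?case by simp
next
  case (Cons i js)
  define G where "G = (\<lambda>x. \<Sum>n\<le>N. of_real \<tau> ^ n * conj_word \<xi> js n f x)"
  have sm: "smooth_on (\<lambda>x. of_real \<tau> ^ n * conj_word \<xi> js n f x) S" for n
    using f by (intro smooth_cmult smooth_conj_word)
  have G: "smooth_on G S"
    unfolding G_def using sm by (intro smooth_sum)
  have "pderiv_at i (pderivs js (\<lambda>x. f x * expw (\<tau> *\<^sub>R \<xi>) x)) x = pderiv_at i (\<lambda>x. G x * expw (\<tau> *\<^sub>R \<xi>) x) x"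
    using Cons by (intro pderiv_at_cong[OF S]) (auto simp: G_def)
  also have "\<dots> = (pderiv_at i G x + of_real \<tau> * of_real (\<xi> $ i) * G x) * expw (\<tau> *\<^sub>R \<xi>) x"
    using Cons.prems by (simp add: pderiv_at_mult[OF G smooth_on_expw] pderiv_at_expw algebra_simps)
  also have "pderiv_at i G x = (\<Sum>n\<le>N. of_real \<tau> ^ n * pderiv_at i (conj_word \<xi> js n f) x)"
    unfolding G_def using Cons.prems f sm by (simp add: pderiv_at_sum pderiv_at_cmult smooth_conj_word)
  also have "of_real \<tau> * of_real (\<xi> $ i) * G x =
      (\<Sum>n\<le>N. of_real \<tau> ^ n * (of_real (\<xi> $ i) * (case n of 0 \<Rightarrow> 0 | Suc k \<Rightarrow> conj_word \<xi> js k f x)))"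
  proof -
    \<comment> \<open>The word \<open>js\<close> is shorter than \<open>N\<close>, so
      \<open>G\<close> has degree at most \<open>N - 1\<close> in \<tau>, and multiplying by \<tau>
      stays within the range of summation.\<close>
    obtain M where M: "N = Suc M" "length js \<le> M" using Cons.prems by (cases N) auto
    have "G x = (\<Sum>n\<le>M. of_real \<tau> ^ n * conj_word \<xi> js n f x)"
      using M by (simp add: G_def conj_word_zero)
    then show ?thesis
      unfolding M(1) by (subst sum.atMost_Suc_shift) (simp add: sum_distrib_left mult_ac)
  qed
  finally show ?case
    by (simp add: sum.distrib[symmetric] algebra_simps)
qed

lemma diff_op_mult_expw:
  assumes "smooth_on f S" "x \<in> S"
  shows "diff_op m a (\<lambda>x. f x * expw (\<tau> *\<^sub>R \<xi>) x) x
    = (\<Sum>n\<le>m. of_real \<tau> ^ n * conj_op m a \<xi> n f x) * expw (\<tau> *\<^sub>R \<xi>) x"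
proof -
  have "diff_op m a (\<lambda>x. f x * expw (\<tau> *\<^sub>R \<xi>) x) x = (\<Sum>q | mi_size q \<le> m.
      a q x * ((\<Sum>n\<le>m. of_real \<tau> ^ n * conj_word \<xi> (mi_word q) n f x) * expw (\<tau> *\<^sub>R \<xi>) x))"
    unfolding diff_op_def mi_deriv_eq_pderivs
    by (rule sum.cong[OF refl], subst pderivs_mult_expw[OF assms, where N = m]) (auto simp: length_mi_word)
  also have "\<dots> = (\<Sum>q | mi_size q \<le> m. \<Sum>n\<le>m.
      of_real \<tau> ^ n * (a q x * conj_word \<xi> (mi_word q) n f x) * expw (\<tau> *\<^sub>R \<xi>) x)"
    by (simp add: sum_distrib_left sum_distrib_right mult_ac)
  also have "\<dots> = (\<Sum>n\<le>m. of_real \<tau> ^ n * conj_op m a \<xi> n f x) * expw (\<tau> *\<^sub>R \<xi>) x"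
    by (subst sum.swap) (simp add: conj_op_def sum_distrib_left sum_distrib_right)
  finally show ?thesis .
qed

lemma smooth_laplacian: "smooth_on f S \<Longrightarrow> smooth_on (laplacian f) S"
  unfolding laplacian_def[abs_def] by (intro smooth_sum smooth_on_pderiv_at)

lemma smooth_schroedinger: "smooth_on R S \<Longrightarrow> smooth_on f S \<Longrightarrow> smooth_on (schroedinger R f) S"
  using smooth_add[OF smooth_cmult[OF smooth_laplacian, of f "-1"] smooth_mult[of R f]]
  unfolding schroedinger_def[abs_def] by simp

lemma laplacian_cong:
  assumes "x \<in> S" "\<And>y. y \<in> S \<Longrightarrow> f y = g y"
  shows "laplacian f x = laplacian g x"
  using pderivs_cong[OF S assms(1), of f g "[i,i]" for i, OF assms(2)]
  unfolding laplacian_def by simp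

lemma schroedinger_cong:
  "x \<in> S \<Longrightarrow> (\<And>y. y \<in> S \<Longrightarrow> f y = g y) \<Longrightarrow> schroedinger R f x = schroedinger R g x"
  using laplacian_cong[of x f g] by (simp add: schroedinger_def)

lemma schroedinger_mult_expw:
  assumes f: "smooth_on f S" and x: "x \<in> S"
  shows "schroedinger R (\<lambda>x. f x * expw (\<tau> *\<^sub>R \<xi>) x) x =
    (schroedinger R f x - 2 * of_real \<tau> * dderiv \<xi> f x - of_real (\<tau>\<^sup>2 * (\<xi> \<bullet> \<xi>)) * f x) * expw (\<tau> *\<^sub>R \<xi>) x"
proof -
  have "laplacian (\<lambda>x. f x * expw (\<tau> *\<^sub>R \<xi>) x) x = (\<Sum>i\<in>UNIV. (pderiv_at i (pderiv_at i f) x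
     + of_real \<tau> * (2 * of_real (\<xi> $ i) * pderiv_at i f x)
     + of_real \<tau> ^ 2 * (of_real (\<xi> $ i) ^ 2 * f x)) * expw (\<tau> *\<^sub>R \<xi>) x)"
    unfolding laplacian_def
  proof (rule sum.cong[OF refl])
    fix i
    have "pderivs [i, i] (\<lambda>x. f x * expw (\<tau> *\<^sub>R \<xi>) x) x
      = (\<Sum>n\<le>2. of_real \<tau> ^ n * conj_word \<xi> [i,i] n f x) * expw (\<tau> *\<^sub>R \<xi>) x"
      by (rule pderivs_mult_expw[OF f x]) simp
    then show "pderiv_at i (pderiv_at i (\<lambda>x. f x * expw (\<tau> *\<^sub>R \<xi>) x)) x = (pderiv_at i (pderiv_at i f) x
     + of_real \<tau> * (2 * of_real (\<xi> $ i) * pderiv_at i f x)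
     + of_real \<tau> ^ 2 * (of_real (\<xi> $ i) ^ 2 * f x)) * expw (\<tau> *\<^sub>R \<xi>) x"
      using f x by (simp add: numeral_2_eq_2 pderiv_at_const pderiv_at_cmult distrib_right)
  qed
  also have "\<dots> = (laplacian f x + 2 * of_real \<tau> * dderiv \<xi> f x + of_real (\<tau>\<^sup>2 * (\<xi> \<bullet> \<xi>)) * f x) * expw (\<tau> *\<^sub>R \<xi>) x"
    unfolding sum_distrib_right[symmetric] sum.distrib laplacian_def dderiv_def inner_vec_def
    by (simp add: sum_distrib_left power2_eq_square mult_ac)
  finally show ?thesis
    by (simp add: schroedinger_def algebra_simps)
qed

text \<open>Comparison of powers of \<open>\<tau>\<close> in \<open>[L, P] (f e\<^bsup>\<tau> \<xi> \<bullet> x\<^esup>) = 0\<close>; the terms with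
  \<open>\<xi> \<bullet> \<xi>\<close> cancel.\<close>

lemma commute_expansion:
  assumes commute: "commute_on S (schroedinger R) (diff_op m a)"
    and R: "smooth_on R S" and a: "\<And>q. mi_size q \<le> m \<Longrightarrow> smooth_on (a q) S"
    and f: "smooth_on f S" and \<xi>f: "\<And>x. x \<in> S \<Longrightarrow> dderiv \<xi> f x = 0"
    and x: "x \<in> S" and n: "n \<le> m"
  shows "schroedinger R (conj_op m a \<xi> n f) x
     - 2 * (case n of 0 \<Rightarrow> 0 | Suc k \<Rightarrow> dderiv \<xi> (conj_op m a \<xi> k f) x)
     = conj_op m a \<xi> n (schroedinger R f) x"
proof -
  let ?P = "\<lambda>n. conj_op m a \<xi> n f"
  have P: "smooth_on (?P n) S" for n by (rule smooth_conj_op[OF a f])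
  have Lf: "smooth_on (schroedinger R f) S" by (rule smooth_schroedinger[OF R f])
  define c where "c n = schroedinger R (?P n) x - conj_op m a \<xi> n (schroedinger R f) x" for n
  \<comment> \<open>The derivative along \<xi> carries an extra factor \<tau>, so the degree is
    \<open>m + 1\<close>. The side where \<open>L\<close> acts first contributes no such term, since
    \<open>f\<close> is constant along \<xi>.\<close>
  have "(\<Sum>n\<le>Suc m. ((if n \<le> m then c n else 0) - 2 * (case n of 0 \<Rightarrow> 0 | Suc k \<Rightarrow> dderiv \<xi> (?P k) x)) * of_real \<tau> ^ n) = 0"
    for \<tau>
  proof -
    let ?e = "expw (\<tau> *\<^sub>R \<xi>)"
    define t where "t = complex_of_real \<tau>"
    define k where "k = complex_of_real (\<tau>\<^sup>2 * (\<xi> \<bullet> \<xi>))"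
    define G where "G = (\<lambda>x. \<Sum>n\<le>m. t ^ n * ?P n x)"
    have G: "smooth_on G S" unfolding G_def using P by (intro smooth_sum smooth_cmult)
    have fe: "smooth_on (\<lambda>x. f x * ?e x) S" using f by (intro smooth_mult smooth_on_expw)
    have "schroedinger R (diff_op m a (\<lambda>x. f x * ?e x)) x = schroedinger R (\<lambda>x. G x * ?e x) x"
      using x by (rule schroedinger_cong) (simp add: diff_op_mult_expw[OF f] G_def t_def)
    also have "\<dots> = (schroedinger R G x - 2 * t * dderiv \<xi> G x - k * G x) * ?e x"
      by (simp add: schroedinger_mult_expw[OF G x] t_def k_def)
    finally have LP: "schroedinger R (diff_op m a (\<lambda>x. f x * ?e x)) x
       = (schroedinger R G x - 2 * t * dderiv \<xi> G x - k * G x) * ?e x" .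
    have "diff_op m a (schroedinger R (\<lambda>x. f x * ?e x)) x
        = diff_op m a (\<lambda>x. schroedinger R f x * ?e x + (-k) * (f x * ?e x)) x"
      unfolding diff_op_def mi_deriv_eq_pderivs
      by (intro sum.cong refl arg_cong2[where f = "(*)"] pderivs_cong[OF S x])
         (simp add: schroedinger_mult_expw[OF f] \<xi>f k_def algebra_simps)
    also have "\<dots> = diff_op m a (\<lambda>x. schroedinger R f x * ?e x) x + (-k) * diff_op m a (\<lambda>x. f x * ?e x) x"
    proof -
      have "pderivs js (\<lambda>x. schroedinger R f x * ?e x + (-k) * (f x * ?e x)) x
          = pderivs js (\<lambda>x. schroedinger R f x * ?e x) x + (-k) * pderivs js (\<lambda>x. f x * ?e x) x" for js
        using pderivs_add[OF smooth_mult[OF Lf smooth_on_expw] smooth_cmult[OF fe] x]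
        by (simp only: pderivs_cmult[OF fe x])
      then show ?thesis
        unfolding diff_op_def mi_deriv_eq_pderivs
        by (simp only: sum.distrib distrib_left sum_distrib_left mult.left_commute)
    qed
    also have "\<dots> = ((\<Sum>n\<le>m. t ^ n * conj_op m a \<xi> n (schroedinger R f) x) - k * G x) * ?e x"
      by (simp add: diff_op_mult_expw[OF f x] diff_op_mult_expw[OF Lf x] G_def t_def algebra_simps)
    finally have PL: "diff_op m a (schroedinger R (\<lambda>x. f x * ?e x)) x
       = ((\<Sum>n\<le>m. t ^ n * conj_op m a \<xi> n (schroedinger R f) x) - k * G x) * ?e x" .
    have "schroedinger R (diff_op m a (\<lambda>x. f x * ?e x)) x = diff_op m a (schroedinger R (\<lambda>x. f x * ?e x)) x"
      using commute fe x by (simp add: commute_on_def)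
    then have eq: "schroedinger R G x - 2 * t * dderiv \<xi> G x = (\<Sum>n\<le>m. t ^ n * conj_op m a \<xi> n (schroedinger R f) x)"
      unfolding LP PL by (simp add: expw_nonzero)
    have pG: "pderiv_at i G y = (\<Sum>n\<le>m. t ^ n * pderiv_at i (?P n) y)" if "y \<in> S" for i y
      unfolding G_def using P that by (simp add: pderiv_at_sum smooth_cmult pderiv_at_cmult)
    have ppG: "pderiv_at i (pderiv_at i G) x = (\<Sum>n\<le>m. t ^ n * pderiv_at i (pderiv_at i (?P n)) x)" for i
    proof -
      have "pderiv_at i (pderiv_at i G) x = pderiv_at i (\<lambda>y. \<Sum>n\<le>m. t ^ n * pderiv_at i (?P n) y) x"
        by (rule pderiv_at_cong[OF S x]) (rule pG)
      then show ?thesis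
        using P x by (simp add: pderiv_at_sum smooth_cmult pderiv_at_cmult smooth_on_pderiv_at)
    qed
    have LG: "schroedinger R G x = (\<Sum>n\<le>m. t ^ n * schroedinger R (?P n) x)"
    proof -
      have "laplacian G x = (\<Sum>n\<le>m. t ^ n * laplacian (?P n) x)"
        unfolding laplacian_def ppG by (subst sum.swap) (simp add: sum_distrib_left)
      then show ?thesis
        by (simp add: schroedinger_def G_def sum_distrib_left sum.distrib sum_negf sum_subtractf algebra_simps)
    qed
    have DG: "dderiv \<xi> G x = (\<Sum>n\<le>m. t ^ n * dderiv \<xi> (?P n) x)"
      unfolding dderiv_def pG[OF x] sum_distrib_left by (subst sum.swap) (simp add: mult_ac)
    have "(\<Sum>n\<le>Suc m. (case n of 0 \<Rightarrow> 0 | Suc k \<Rightarrow> dderiv \<xi> (?P k) x) * t ^ n) = t * dderiv \<xi> G x"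
      unfolding DG by (subst sum.atMost_Suc_shift) (simp add: sum_distrib_left mult_ac)
    moreover have "(\<Sum>n\<le>Suc m. (if n \<le> m then c n else 0) * t ^ n) = (\<Sum>n\<le>m. c n * t ^ n)"
      by simp
    moreover have "(\<Sum>n\<le>m. c n * t ^ n) = 2 * t * dderiv \<xi> G x"
    proof -
      have "(\<Sum>n\<le>m. c n * t ^ n) = schroedinger R G x - (\<Sum>n\<le>m. t ^ n * conj_op m a \<xi> n (schroedinger R f) x)"
        unfolding LG c_def by (simp add: right_diff_distrib sum_subtractf mult.commute)
      then show ?thesis using eq by (simp add: algebra_simps)
    qed
    ultimately show ?thesis
      unfolding t_def[symmetric]
      by (simp only: left_diff_distrib sum_subtractf mult.assoc sum_distrib_left[symmetric] diff_self)
  qed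
  from real_polynomial_coeffs_zero[OF this, of n] n show ?thesis
    by (simp add: c_def algebra_simps)
qed

end

subsection \<open>Leading asymptotics of conjugated operators\<close>

text \<open>The leading coefficient of \<open>conj_word\<close> on \<open>u^s\<close>, as a
  polynomial in \<open>s\<close>. The word \<open>js\<close> with \<open>n\<close> factors \<tau>
  leaves the exponent \<open>s + n - length js\<close>, and this is the linear factor produced by
  one more derivative.\<close>

primrec conj_poly :: "real ^ 'n \<Rightarrow> real ^ 'n \<Rightarrow> 'n list \<Rightarrow> nat \<Rightarrow> complex poly" where
  "conj_poly \<alpha> \<xi> [] n = (if n = 0 then 1 else 0)"
| "conj_poly \<alpha> \<xi> (i # js) n =
     smult (of_real (\<alpha> $ i)) ([:of_nat n - of_nat (length js), 1:] * conj_poly \<alpha> \<xi> js n) +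
     (case n of 0 \<Rightarrow> 0 | Suc k \<Rightarrow> smult (of_real (\<xi> $ i)) (conj_poly \<alpha> \<xi> js k))"

text \<open>The monomial of the word restricted to the line
  \<open>\<xi> + \<sigma> \<alpha>\<close>, as a polynomial in \<sigma>.\<close>

definition word_poly :: "real ^ 'n \<Rightarrow> real ^ 'n \<Rightarrow> 'n list \<Rightarrow> complex poly" where
  "word_poly \<alpha> \<xi> js = prod_list (map (\<lambda>i. [:of_real (\<xi> $ i), of_real (\<alpha> $ i):]) js)"

lemma conj_poly_zero: "length js < n \<Longrightarrow> conj_poly \<alpha> \<xi> js n = 0"
  by (induction js arbitrary: n) (auto split: nat.split)

lemma coeff_word_poly_zero:
  assumes "length js < k"
  shows "coeff (word_poly \<alpha> \<xi> js) k = 0"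
proof -
  have "degree (word_poly \<alpha> \<xi> js) \<le> length js"
    unfolding word_poly_def
  proof (induction js)
    case (Cons i js)
    have "degree [:complex_of_real (\<xi> $ i), of_real (\<alpha> $ i):] \<le> 1" by (simp add: degree_pCons_le)
    from order_trans[OF degree_mult_le add_mono[OF this Cons]] show ?case by (simp del: mult_pCons_left)
  qed simp
  then show ?thesis using assms by (simp add: coeff_eq_0)
qed

text \<open>Each letter contributes either a factor linear in \<open>s\<close> or a factor \<tau>,
  so the degree in \<open>s\<close> is at most \<open>length js - n\<close>. In that top degree the
  shifts of the exponent are invisible, and \<open>s\<close> plays the part of \<sigma>.\<close>

lemma coeff_conj_poly:
  "length js \<le> k + n \<Longrightarrow>
   coeff (conj_poly \<alpha> \<xi> js n) k = (if k + n = length js then coeff (word_poly \<alpha> \<xi> js) k else 0)"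
proof (induction js arbitrary: k n)
  case Nil
  then show ?case by (auto simp: word_poly_def)
next
  case (Cons i js)
  have 1: "coeff (conj_poly \<alpha> \<xi> js n) k = 0" using Cons by simp
  have 2: "coeff (word_poly \<alpha> \<xi> (i # js)) k = of_real (\<xi> $ i) * coeff (word_poly \<alpha> \<xi> js) k +
      of_real (\<alpha> $ i) * (case k of 0 \<Rightarrow> 0 | Suc l \<Rightarrow> coeff (word_poly \<alpha> \<xi> js) l)"
    by (simp add: word_poly_def coeff_pCons split: nat.split)
  show ?case
    using Cons.prems 1 by (auto simp: 2 coeff_word_poly_zero Cons.IH coeff_pCons split: nat.split)
qed

lemma poly_word_poly: "poly (word_poly \<alpha> \<xi> (mi_word q)) (of_real \<sigma>) = of_real (mi_power (\<xi> + \<sigma> *\<^sub>R \<alpha>) q)"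
proof -
  have "poly (word_poly \<alpha> \<xi> js) (of_real \<sigma>) = prod_list (map (\<lambda>i. of_real ((\<xi> + \<sigma> *\<^sub>R \<alpha>) $ i)) js)" for js
    by (induction js) (auto simp: word_poly_def algebra_simps)
  then show ?thesis by (simp add: prod_list_mi_word mi_power_def)
qed

lemma conj_word_one:
  "conj_word \<xi> js n (\<lambda>x. 1) = (\<lambda>x. if n = length js then prod_list (map (\<lambda>i. of_real (\<xi> $ i)) js) else 0)"
proof (induction js arbitrary: n)
  case (Cons i js)
  interpret open_domain UNIV by unfold_locales simp
  show ?case by (auto simp: Cons.IH pderiv_at_const split: nat.split)
qed auto

context wall
begin

lemma T_conj_word:
  "T s c f \<Longrightarrow> T (s - real (length js) + real n) (c * poly (conj_poly \<alpha> \<xi> js n) (of_real s)) (conj_word \<xi> js n f)"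
proof (induction js arbitrary: n)
  case Nil
  then show ?case by (auto simp: T_zero)
next
  case (Cons i js)
  have 1: "T (s - real (length (i # js)) + real n)
     (c * (of_real (\<alpha> $ i) * ((of_nat n - of_nat (length js) + of_real s) * poly (conj_poly \<alpha> \<xi> js n) (of_real s))))
     (pderiv_at i (conj_word \<xi> js n f))"
    using T_pderiv_at[OF Cons.IH[OF Cons.prems, of n], of i] by (simp add: algebra_simps)
  have 2: "T (s - real (length (i # js)) + real n)
     (c * poly (case n of 0 \<Rightarrow> 0 | Suc k \<Rightarrow> smult (of_real (\<xi> $ i)) (conj_poly \<alpha> \<xi> js k)) (of_real s))
     (\<lambda>x. of_real (\<xi> $ i) * (case n of 0 \<Rightarrow> 0 | Suc k \<Rightarrow> conj_word \<xi> js k f x))"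
  proof (cases n)
    case 0
    then show ?thesis by (simp add: T_zero)
  next
    case (Suc k)
    then show ?thesis using T_cmult[OF Cons.IH[OF Cons.prems, of k], of "of_real (\<xi> $ i)"] by (simp add: algebra_simps)
  qed
  show ?case using T_add[OF 1 2] by (simp add: algebra_simps)
qed

text \<open>The pole of order \<open>m - |q|\<close> and the loss \<open>|q| - n\<close> from the
  derivatives add up to \<open>m - n\<close> for every \<open>q\<close>, so all terms share one
  exponent. Only coefficients with \<open>|q| \<ge> n\<close> are involved, which lets the induction
  on the order proceed from the top.\<close>

lemma T_conj_op:
  assumes a: "\<And>q. mi_size q \<le> m \<Longrightarrow> n \<le> mi_size q \<Longrightarrow> T (- real (m - mi_size q)) (c q) (a q)"
    and f: "T s b f"
  shows "T (s - real m + real n) (b * (\<Sum>q | mi_size q \<le> m. c q * poly (conj_poly \<alpha> \<xi> (mi_word q) n) (of_real s)))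
    (conj_op m a \<xi> n f)"
proof -
  have "T (s - real m + real n) (b * (c q * poly (conj_poly \<alpha> \<xi> (mi_word q) n) (of_real s)))
     (\<lambda>x. a q x * conj_word \<xi> (mi_word q) n f x)" if q: "mi_size q \<le> m" for q
  proof (cases "n \<le> mi_size q")
    case True
    show ?thesis
      using T_mult[OF a[OF q True] T_conj_word[OF f, of "mi_word q" n \<xi>]] q
      by (simp add: length_mi_word algebra_simps of_nat_diff)
  next
    case False
    then show ?thesis by (simp add: conj_word_zero conj_poly_zero length_mi_word T_zero)
  qed
  then show ?thesis
    unfolding conj_op_def[abs_def] sum_distrib_left by (intro T_sum) auto
qed

lemma T_dderiv: "T k c f \<Longrightarrow> T (k - 1) (c * of_real (k * (\<alpha> \<bullet> \<xi>))) (dderiv \<xi> f)"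
proof -
  assume f: "T k c f"
  have "T (k - 1) (\<Sum>i\<in>UNIV. of_real (\<xi> $ i) * (c * of_real (k * \<alpha> $ i))) (dderiv \<xi> f)"
    unfolding dderiv_def[abs_def] by (intro T_sum T_cmult T_pderiv_at f)
  then show ?thesis by (simp add: inner_vec_def sum_distrib_left mult_ac)
qed

lemma T_laplacian: "T k c f \<Longrightarrow> T (k - 2) (c * of_real (k * (k - 1) * (\<alpha> \<bullet> \<alpha>))) (laplacian f)"
proof -
  assume f: "T k c f"
  have "T (k - 1 - 1) (\<Sum>i\<in>UNIV. c * of_real (k * \<alpha> $ i) * of_real ((k - 1) * \<alpha> $ i)) (laplacian f)"
    unfolding laplacian_def[abs_def] by (intro T_sum T_pderiv_at f)
  then show ?thesis by (simp add: inner_vec_def sum_distrib_left mult_ac)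
qed

text \<open>The factor is the indicial polynomial of \<open>L\<close> at the wall; its zeros drive
  the final recursion.\<close>

lemma T_schroedinger:
  assumes "T (-2) C R" "T k c f"
  shows "T (k - 2) (c * (C - of_real (k * (k - 1) * (\<alpha> \<bullet> \<alpha>)))) (schroedinger R f)"
proof -
  have "T (k - 2) (C * c) (\<lambda>x. R x * f x)"
    using T_mult[OF assms] by (simp add: add.commute[of "-2"])
  from T_add[OF T_cmult[OF T_laplacian[OF assms(2)], of "-1"] this] show ?thesis
    by (simp add: schroedinger_def[abs_def] algebra_simps)
qed

lemma T_const: "T 0 c (\<lambda>x. c)"
  using T_cmult[OF T_wpow, of 0 c] by (subst T_cong[of _ "\<lambda>x. c * wpow \<alpha> 0 x"]) (auto simp: wpow_def \<Omega>_def)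

end

subsection \<open>The recursion for the symbol\<close>

text \<open>At a root \<open>a\<close> of \<open>\<kappa> = a * (a - 1)\<close> the right side
  vanishes, and each zero of \<open>Q\<close> makes the right side vanish two units further on. If
  the left factor never vanishes along \<open>a + 2j\<close>, then \<open>Q\<close> has infinitely
  many zeros.\<close>

lemma shift_recursion_zero:
  fixes Q :: "complex poly" and l :: nat
  assumes rec: "\<And>z. (\<kappa> - (z - of_nat l) * (z - of_nat l - 1)) * poly Q z = (\<kappa> - z * (z - 1)) * poly Q (z - 2)"
    and l: "odd l" and \<kappa>: "\<And>k :: int. \<kappa> \<noteq> of_int (k * (k + 1))"
  shows "Q = 0"
proof (rule ccontr)
  assume "Q \<noteq> 0"
  define a where "a = (1 + csqrt (1 + 4 * \<kappa>)) / 2"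
  have "2 * a - 1 = csqrt (1 + 4 * \<kappa>)" by (simp add: a_def field_simps)
  then have "(2 * a - 1)\<^sup>2 = 1 + 4 * \<kappa>" by simp
  then have "4 * \<kappa> = 4 * (a * (a - 1))" by (simp add: power2_eq_square algebra_simps)
  then have a: "\<kappa> = a * (a - 1)" by (simp only: mult_cancel_left) simp
  \<comment> \<open>A zero here would make \<open>2 * a\<close> an even integer, as
    \<open>l + 1\<close> is even, and \<kappa> a product of consecutive integers.\<close>
  have nz: "2 * a + 2 * of_nat j - of_nat l - 1 \<noteq> 0" for j :: nat
  proof
    assume *: "2 * a + 2 * of_nat j - of_nat l - 1 = 0"
    obtain h where h: "l = 2 * h + 1" using l by (auto elim: oddE)
    define i where "i = int h - int j"
    have "2 * a = 2 * (of_int i + 1)" using * by (simp add: h i_def algebra_simps)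
    then have "a = of_int i + 1" by (simp only: mult_cancel_left) simp
    then have "\<kappa> = of_int (i * (i + 1))" by (simp add: a)
    then show False using \<kappa> by blast
  qed
  have step: "poly Q (a + 2 * of_nat j) = 0"
    if "(\<kappa> - (a + 2 * of_nat j) * (a + 2 * of_nat j - 1)) * poly Q (a + 2 * of_nat j - 2) = 0" for j :: nat
  proof -
    have "(\<kappa> - (a + 2 * of_nat j - of_nat l) * (a + 2 * of_nat j - of_nat l - 1)) * poly Q (a + 2 * of_nat j) = 0"
      using that by (simp add: rec)
    \<comment> \<open>The zeros of the indicial polynomial are \<open>a\<close> and
      \<open>1 - a\<close>, one for each factor.\<close>
    moreover have "\<kappa> - (a + 2 * of_nat j - of_nat l) * (a + 2 * of_nat j - of_nat l - 1)
        = (of_nat l - of_nat (2 * j)) * (2 * a + 2 * of_nat j - of_nat l - 1)"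
      by (simp add: a algebra_simps)
    moreover have "(of_nat l :: complex) \<noteq> of_nat (2 * j)" using l by (metis dvd_triv_left of_nat_eq_iff)
    ultimately show ?thesis using nz[of j] by simp
  qed
  have root: "poly Q (a + 2 * of_nat j) = 0" for j :: nat
  proof (induction j)
    case 0
    show ?case by (rule step) (simp add: a)
  next
    case (Suc j)
    have "a + 2 * of_nat (Suc j) - 2 = a + 2 * of_nat j" by simp
    then show ?case by (intro step) (simp only: Suc.IH mult_zero_right)
  qed
  have "inj (\<lambda>j::nat. a + 2 * of_nat j)" by (auto simp: inj_def)
  then have "infinite (range (\<lambda>j::nat. a + 2 * of_nat j))" using finite_imageD infinite_UNIV_nat by blast
  moreover have "range (\<lambda>j::nat. a + 2 * of_nat j) \<subseteq> {z. poly Q z = 0}" using root by auto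
  ultimately show False using poly_roots_finite[OF \<open>Q \<noteq> 0\<close>] finite_subset by blast
qed

section \<open>Coefficients of the commuting operator at one wall\<close>

locale commuting_wall = wall \<alpha> x\<^sub>0 d
  for \<alpha> x\<^sub>0 :: "real ^ 'n" and d :: real +
  fixes D :: "(real ^ 'n) set" and R :: "real ^ 'n \<Rightarrow> complex" and m :: nat
    and a :: "('n \<Rightarrow> nat) \<Rightarrow> real ^ 'n \<Rightarrow> complex" and A :: "('n \<Rightarrow> nat) \<Rightarrow> complex" and C :: complex
  assumes open_D: "open D" and \<Omega>_D: "\<Omega> \<subseteq> D" and D_nonzero: "D \<subseteq> {x. \<alpha> \<bullet> x \<noteq> 0}"
    and commute: "commute_on D (schroedinger R) (diff_op m a)"
    and R_smooth: "smooth_on R D"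
    and a_smooth: "\<And>q. mi_size q \<le> m \<Longrightarrow> smooth_on (a q) D"
    and a_commute: "\<And>q. mi_size q \<le> m \<Longrightarrow> derivs_commute_on (a q) \<Omega>"
    and a_const: "\<And>q x. mi_size q = m \<Longrightarrow> x \<in> \<Omega> \<Longrightarrow> a q x = A q"
    and T_R: "T (-2) C R"
begin

text \<open>The condition on \<open>s\<close> and \<xi> says that \<open>u^s\<close> is constant
  along \<xi>. It covers both uses: \<open>s = 0\<close> with arbitrary \<xi> for the transport
  equations, and arbitrary \<open>s\<close> with \<xi> tangential to the wall for the
  recursion.\<close>

lemma expansion:
  assumes "s * (\<alpha> \<bullet> \<xi>) = 0" "x \<in> \<Omega>" "n \<le> m"
  shows "schroedinger R (conj_op m a \<xi> n (wpow \<alpha> s)) x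
     - 2 * (case n of 0 \<Rightarrow> 0 | Suc k \<Rightarrow> dderiv \<xi> (conj_op m a \<xi> k (wpow \<alpha> s)) x)
     = conj_op m a \<xi> n (schroedinger R (wpow \<alpha> s)) x"
proof -
  interpret D: open_domain D by unfold_locales (rule open_D)
  show ?thesis
  proof (rule D.commute_expansion[OF commute R_smooth a_smooth])
    show "smooth_on (wpow \<alpha> s) D" by (rule smooth_on_subset[OF smooth_on_wpow D_nonzero])
    show "dderiv \<xi> (wpow \<alpha> s) x = 0" if "x \<in> D" for x
      using dderiv_eq[OF wpow_has_derivative, of \<alpha> x \<xi> s] that D_nonzero assms(1) by auto
    show "x \<in> D" using assms(2) \<Omega>_D by blast
  qed (use assms(3) in auto)
qed

lemma a_smooth_\<Omega>: "mi_size q \<le> m \<Longrightarrow> smooth_on (a q) \<Omega>"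
  using a_smooth \<Omega>_D smooth_on_subset by blast

lemma T_top: "mi_size q = m \<Longrightarrow> T 0 (A q) (a q)"
  using T_const[of "A q"] a_const by (subst T_cong[of _ "\<lambda>x. A q"]) auto

lemma conj_op_wpow_0:
  assumes "x \<in> \<Omega>" "k \<le> m"
  shows "conj_op m a \<xi> k (wpow \<alpha> 0) x = (\<Sum>q | mi_size q = k. a q x * of_real (mi_power \<xi> q))"
proof -
  have "conj_op m a \<xi> k (wpow \<alpha> 0) x
      = (\<Sum>q | mi_size q \<le> m. a q x * (if k = mi_size q then of_real (mi_power \<xi> q) else 0))"
    unfolding conj_op_def
  proof (rule sum.cong[OF refl])
    fix q :: "'n \<Rightarrow> nat"
    have "conj_word \<xi> (mi_word q) k (wpow \<alpha> 0) x = conj_word \<xi> (mi_word q) k (\<lambda>x. 1) x"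
      using assms(1) by (rule conj_word_cong) (auto simp: wpow_def \<Omega>_def)
    then show "a q x * conj_word \<xi> (mi_word q) k (wpow \<alpha> 0) x
        = a q x * (if k = mi_size q then of_real (mi_power \<xi> q) else 0)"
      by (simp add: conj_word_one length_mi_word prod_list_mi_word mi_power_def)
  qed
  also have "\<dots> = (\<Sum>q | mi_size q = k. a q x * of_real (mi_power \<xi> q))"
    using assms(2) by (intro sum.mono_neutral_cong_right finite_mi_size_le) auto
  finally show ?thesis .
qed

text \<open>With \<open>k = m - j\<close>, the coefficient of \<open>\<tau>^(k+1)\<close> in the
  relation for the constant function 1 expresses the derivative along \<xi> of the degree
  \<open>k\<close> part of the symbol by coefficients of order above \<open>k\<close>. These have
  smaller \<open>j\<close>, so their leading terms are known; integration gives the symbol for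
  transversal \<xi>, and varying \<xi> isolates \<open>a q\<close>.\<close>

lemma T_coeff:
  "j \<le> m \<Longrightarrow> mi_size q = m - j \<Longrightarrow> \<exists>c. T (- real j) c (a q)"
proof (induction j arbitrary: q rule: less_induct)
  case (less j)
  show ?case
  proof (cases j)
    case 0
    then show ?thesis using T_top[of q] less.prems by auto
  next
    case (Suc i)
    define k where "k = m - j"
    have k: "Suc k \<le> m" "m - Suc k = i" using less.prems Suc by (auto simp: k_def)
    have "\<exists>c. T (- real (m - mi_size q)) c (a q)" if "mi_size q \<le> m" "Suc k \<le> mi_size q" for q
      using that less.prems Suc by (intro less.IH) (auto simp: k_def)
    then obtain c where c: "\<And>q. mi_size q \<le> m \<Longrightarrow> Suc k \<le> mi_size q \<Longrightarrow> T (- real (m - mi_size q)) (c q) (a q)"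
      by metis
    define V where "V = {f. \<exists>c. T (- real j) c f}"
    show ?thesis
    proof -
      have "a q \<in> V"
      proof (rule symbol_extract[where V = V and m = k and a = a])
        show "(\<lambda>x. f x + g x) \<in> V" if "f \<in> V" "g \<in> V" for f g
          using that T_add unfolding V_def by blast
        show "(\<lambda>x. b * f x) \<in> V" if "f \<in> V" for b f
          using that T_cmult unfolding V_def by blast
        show "(\<lambda>x. 0) \<in> V" using T_zero unfolding V_def by blast
        show "\<alpha> \<noteq> 0" by (rule \<alpha>)
        show "mi_size q = k" using less.prems by (simp add: k_def)
        fix \<xi> assume \<xi>: "\<alpha> \<bullet> \<xi> \<noteq> 0"
        define g where "g = (\<lambda>x. \<Sum>q | mi_size q = k. a q x * of_real (mi_power \<xi> q))"
        have sm: "smooth_on (\<lambda>x. a q x * of_real (mi_power \<xi> q)) \<Omega>" if "mi_size q = k" for q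
          using smooth_cmult[OF a_smooth_\<Omega>, of q "of_real (mi_power \<xi> q)"] that k by (simp add: mult.commute)
        have cm: "derivs_commute_on (\<lambda>x. a q x * of_real (mi_power \<xi> q)) \<Omega>" if "mi_size q = k" for q
          using derivs_commute_cmult[OF a_commute a_smooth_\<Omega>, of q "of_real (mi_power \<xi> q)"] that k
          by (simp add: mult.commute)
        have "\<exists>b. T (- real j - 1) b (dderiv \<xi> g)"
        proof -
          let ?f = "wpow \<alpha> 0"
          \<comment> \<open>Whether \<open>L\<close> acts after or before \<open>P\<close>, it
            lowers the exponent by 2, so both terms have the order \<open>-j - 1\<close> of a
            differentiated \<open>u^(-j)\<close>.\<close>
          have e1: "0 - real m + real (Suc k) - 2 = - real j - 1" "0 - 2 - real m + real (Suc k) = - real j - 1"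
            using less.prems by (auto simp: k_def Suc of_nat_diff)
          have op: "\<exists>b'. T (s - real m + real (Suc k)) b' (conj_op m a \<xi> (Suc k) f)" if "T s b f" for s b f
            using T_conj_op[of m "Suc k" c a s b f \<xi>] c that by blast
          obtain b0 where "T (0 - real m + real (Suc k)) b0 (conj_op m a \<xi> (Suc k) ?f)"
            using op[OF T_wpow] by blast
          from T_schroedinger[OF T_R this]
          obtain b1 where b1: "T (- real j - 1) b1 (schroedinger R (conj_op m a \<xi> (Suc k) ?f))"
            unfolding e1(1) by blast
          obtain b2 where b2: "T (- real j - 1) b2 (conj_op m a \<xi> (Suc k) (schroedinger R ?f))"
            using op[OF T_schroedinger[OF T_R T_wpow[of 0]]] unfolding e1(2) by blast
          have "dderiv \<xi> g x = (1/2) * (schroedinger R (conj_op m a \<xi> (Suc k) ?f) x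
              + (-1) * conj_op m a \<xi> (Suc k) (schroedinger R ?f) x)" if "x \<in> \<Omega>" for x
          proof -
            have "dderiv \<xi> (conj_op m a \<xi> k ?f) x = dderiv \<xi> g x"
              using that k by (intro dderiv_cong) (auto simp: g_def conj_op_wpow_0)
            then show ?thesis
              using expansion[of 0 \<xi> x "Suc k"] that k by (simp add: algebra_simps)
          qed
          then show ?thesis
            using T_cmult[OF T_add[OF b1 T_cmult[OF b2, of "-1"]], of "1/2"]
            by (subst T_cong[where g = "\<lambda>x. (1/2) * (schroedinger R (conj_op m a \<xi> (Suc k) ?f) x
              + (-1) * conj_op m a \<xi> (Suc k) (schroedinger R ?f) x)"]) blast+
        qed
        then obtain b where "T (- real j - 1) b (dderiv \<xi> g)" by blast
        moreover have "smooth_on g \<Omega>" "derivs_commute_on g \<Omega>"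
          unfolding g_def using sm cm by (auto intro!: smooth_sum derivs_commute_sum)
        \<comment> \<open>Here \<open>j\<close> is positive, so \<open>-j < -1/2\<close> as the
          integration requires.\<close>
        ultimately obtain c' where "T (- real j) c' g"
          using T_integrate[of g \<xi> "- real j" b] \<xi> Suc by auto
        then show "(\<lambda>x. \<Sum>q | mi_size q = k. a q x * of_real (mi_power \<xi> q)) \<in> V"
          unfolding g_def V_def by blast
      qed
      then show ?thesis by (simp add: V_def)
    qed
  qed
qed

lemma odd_coeff_zero:
  assumes \<eta>: "\<alpha> \<bullet> \<eta> = 0" and l: "odd l" "l \<le> m"
    and C: "\<And>k :: int. C \<noteq> of_int (k * (k + 1)) * of_real (\<alpha> \<bullet> \<alpha>)"
  shows "(\<Sum>q | mi_size q = m. A q * coeff (word_poly \<alpha> \<eta> (mi_word q)) l) = 0"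
proof -
  \<comment> \<open>This power of \<tau> makes the conjugated operator lower the exponent of
    \<open>u\<close> by exactly \<open>l\<close>.\<close>
  define n where "n = m - l"
  have n: "n \<le> m" "m = n + l" using l by (auto simp: n_def)
  have "\<exists>c. T (- real (m - mi_size q)) c (a q)" if "mi_size q \<le> m" for q
    using that by (intro T_coeff) auto
  then obtain c where c: "\<And>q. mi_size q \<le> m \<Longrightarrow> T (- real (m - mi_size q)) (c q) (a q)"
    by metis
  \<comment> \<open>The numbers \<open>c q\<close> were merely chosen to exist; uniqueness of
    leading coefficients identifies those of top order with the given constants.\<close>
  have cA: "c q = A q" if "mi_size q = m" for q
    using c[of q] T_top[OF that] that T_unique by simp
  define Q where "Q n = (\<Sum>q | mi_size q \<le> m. smult (c q) (conj_poly \<alpha> \<eta> (mi_word q) n))" for n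
  define N where "N = complex_of_real (\<alpha> \<bullet> \<alpha>)"
  have N: "N \<noteq> 0" using \<alpha> by (simp add: N_def)
  have Top: "T (s - real m + real n) (b * poly (Q n) (of_real s)) (conj_op m a \<eta> n f)" if "T s b f" for s b f n
    using T_conj_op[OF c that, where n = n and \<xi> = \<eta>] by (simp add: Q_def poly_sum)
  have real_rec: "poly (Q n) (of_real s) * (C - (of_real s - of_nat l) * (of_real s - of_nat l - 1) * N)
      = (C - of_real s * (of_real s - 1) * N) * poly (Q n) (of_real s - 2)" for s
  proof -
    let ?f = "wpow \<alpha> s"
    let ?s = "s - real m + real n"
    have s: "?s = s - real l" using n by simp
    have 1: "T (?s - 2) (1 * poly (Q n) (of_real s) * (C - of_real (?s * (?s - 1) * (\<alpha> \<bullet> \<alpha>))))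
       (schroedinger R (conj_op m a \<eta> n ?f))"
      by (intro T_schroedinger T_R Top T_wpow)
    \<comment> \<open>The leading coefficient of a derivative along \<eta> contains the factor
      \<open>\<alpha> \<bullet> \<eta> = 0\<close>.\<close>
    have 2: "T (?s - 2) 0 (\<lambda>x. case n of 0 \<Rightarrow> 0 | Suc k \<Rightarrow> dderiv \<eta> (conj_op m a \<eta> k ?f) x)"
    proof (cases n)
      case 0
      then show ?thesis by (simp add: T_zero)
    next
      case (Suc k)
      then show ?thesis using T_dderiv[OF Top[OF T_wpow, of s k], where \<xi> = \<eta>] \<eta> by (simp add: algebra_simps)
    qed
    have "T (s - 2 - real m + real n) (1 * (C - of_real (s * (s - 1) * (\<alpha> \<bullet> \<alpha>))) * poly (Q n) (of_real (s - 2)))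
       (conj_op m a \<eta> n (schroedinger R ?f))"
      by (intro Top T_schroedinger T_R T_wpow)
    then have 3: "T (?s - 2) ((C - of_real (s * (s - 1) * (\<alpha> \<bullet> \<alpha>))) * poly (Q n) (of_real s - 2))
       (conj_op m a \<eta> n (schroedinger R ?f))"
      by (simp add: algebra_simps)
    have "T (?s - 2) (1 * poly (Q n) (of_real s) * (C - of_real (?s * (?s - 1) * (\<alpha> \<bullet> \<alpha>))) + (-2) * 0)
        (conj_op m a \<eta> n (schroedinger R ?f))"
      by (subst T_cong[OF expansion[of s \<eta> _ n, symmetric]])
         (use T_add[OF 1 T_cmult[OF 2, of "-2"]] \<eta> n in auto)
    from T_unique[OF this 3] show ?thesis
      unfolding s by (simp add: N_def mult_ac)
  qed
  have "Q n = 0"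
  proof (rule shift_recursion_zero[where \<kappa> = "C / N" and l = l])
    fix z
    \<comment> \<open>The relation is known for real \<open>s\<close>, but the root starting the
      recursion may be complex. Both sides are polynomials, so their difference \<open>p\<close>
      vanishes identically.\<close>
    define p where "p = [:C - of_nat l * (of_nat l + 1) * N, (2 * of_nat l + 1) * N, - N:] * Q n
       - [:C, N, - N:] * pcompose (Q n) [:-2, 1:]"
    have p: "poly p z = poly (Q n) z * (C - (z - of_nat l) * (z - of_nat l - 1) * N)
        - (C - z * (z - 1) * N) * poly (Q n) (z - 2)" for z
      by (simp add: p_def poly_pcompose algebra_simps)
    have "range complex_of_real \<subseteq> {z. poly p z = 0}" using real_rec p by auto
    moreover have "infinite (range complex_of_real)"
      using finite_imageD[of complex_of_real UNIV] infinite_UNIV_char_0 by (auto simp: inj_def)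
    ultimately have "p = 0" using poly_roots_finite finite_subset by blast
    then have "poly p z = 0" by simp
    then show "(C / N - (z - of_nat l) * (z - of_nat l - 1)) * poly (Q n) z = (C / N - z * (z - 1)) * poly (Q n) (z - 2)"
      using N unfolding p by (simp add: field_simps)
  next
    show "odd l" by fact
    show "C / N \<noteq> of_int (k * (k + 1))" for k
      using C[of k] N by (simp add: N_def field_simps)
  qed
  then have "coeff (Q n) l = 0" by simp
  \<comment> \<open>Since \<open>l + n = m\<close>, a coefficient of order below \<open>m\<close>
    contributes only degrees below \<open>l\<close>.\<close>
  moreover have "coeff (Q n) l = (\<Sum>q | mi_size q \<le> m. if mi_size q = m then A q * coeff (word_poly \<alpha> \<eta> (mi_word q)) l else 0)"
    unfolding Q_def coeff_sum
    by (rule sum.cong[OF refl]) (use n in \<open>auto simp: coeff_conj_poly length_mi_word cA\<close>)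
  moreover have "\<dots> = (\<Sum>q | mi_size q = m. A q * coeff (word_poly \<alpha> \<eta> (mi_word q)) l)"
    by (intro sum.mono_neutral_cong_right finite_mi_size_le) auto
  ultimately show ?thesis by simp
qed

end

context commuting_wall
begin

lemma symbol_even:
  assumes \<eta>: "\<alpha> \<bullet> \<eta> = 0"
    and C: "\<And>k :: int. C \<noteq> of_int (k * (k + 1)) * of_real (\<alpha> \<bullet> \<alpha>)"
  shows "(\<Sum>q | mi_size q = m. A q * of_real (mi_power (\<eta> - \<sigma> *\<^sub>R \<alpha>) q))
       = (\<Sum>q | mi_size q = m. A q * of_real (mi_power (\<eta> + \<sigma> *\<^sub>R \<alpha>) q))"
proof -
  define \<Phi> where "\<Phi> = (\<Sum>q | mi_size q = m. smult (A q) (word_poly \<alpha> \<eta> (mi_word q)))"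
  have odd: "coeff \<Phi> l = 0" if "odd l" for l
  proof (cases "l \<le> m")
    case True
    then show ?thesis
      using odd_coeff_zero[OF \<eta> that True C] by (simp add: \<Phi>_def coeff_sum)
  next
    case False
    then show ?thesis
      by (simp add: \<Phi>_def coeff_sum coeff_word_poly_zero length_mi_word)
  qed
  have \<Phi>: "poly \<Phi> (of_real \<sigma>) = (\<Sum>q | mi_size q = m. A q * of_real (mi_power (\<eta> + \<sigma> *\<^sub>R \<alpha>) q))" for \<sigma>
    by (simp add: \<Phi>_def poly_sum poly_word_poly)
  have "coeff \<Phi> i * (- of_real \<sigma>) ^ i = coeff \<Phi> i * of_real \<sigma> ^ i" for i
    using odd[of i] by (cases "even i") auto
  then have "poly \<Phi> (of_real (-\<sigma>)) = poly \<Phi> (of_real \<sigma>)"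
    unfolding poly_altdef of_real_minus by (intro sum.cong refl)
  then show ?thesis
    unfolding \<Phi> by simp
qed

end

section \<open>A generic wall point and the reflection\<close>

lemma ex_generic_wall_point:
  fixes \<alpha> :: "real ^ 'n"
  assumes "finite B" "\<alpha> \<noteq> 0" "\<And>\<beta>. \<beta> \<in> B \<Longrightarrow> \<not> (\<exists>c. \<beta> = c *\<^sub>R \<alpha>)" "r > 0"
  obtains x where "\<alpha> \<bullet> x = 0" "norm x < r" "\<And>\<beta>. \<beta> \<in> B \<Longrightarrow> \<beta> \<bullet> x \<noteq> 0"
proof -
  \<comment> \<open>The orthogonal projection to the wall. It is non-zero on \<open>B\<close>
    because no element is a multiple of \<alpha>, and being self-adjoint it turns a generic
    \<open>y\<close> into a generic wall point.\<close>
  define proj where "proj \<beta> = \<beta> - ((\<alpha> \<bullet> \<beta>) / (\<alpha> \<bullet> \<alpha>)) *\<^sub>R \<alpha>" for \<beta>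
  have "0 \<notin> proj ` B" using assms(3) by (force simp: proj_def)
  then obtain y where y: "\<And>\<beta>. \<beta> \<in> B \<Longrightarrow> proj \<beta> \<bullet> y \<noteq> 0"
    using ex_inner_nonzero[of "proj ` B"] assms(1) by auto
  define c where "c = r / (2 * (norm (proj y) + 1))"
  define x where "x = c *\<^sub>R proj y"
  have c: "c > 0"
    unfolding c_def using assms(4) by (simp add: add_nonneg_pos)
  show thesis
  proof
    show "\<alpha> \<bullet> x = 0" using assms(2) by (simp add: x_def proj_def inner_diff_right)
    have "norm x = r / 2 * (norm (proj y) / (norm (proj y) + 1))"
      using assms(4) c by (simp add: x_def) (simp add: c_def)
    also have "\<dots> \<le> r / 2 * 1"
      using assms(4) by (intro mult_left_mono) (auto simp: divide_le_eq_1 add_nonneg_pos)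
    finally show "norm x < r" using assms(4) by simp
    fix \<beta> assume "\<beta> \<in> B"
    moreover have "proj \<beta> \<bullet> y = \<beta> \<bullet> proj y"
      by (simp add: proj_def inner_diff_left inner_diff_right inner_commute)
    ultimately show "\<beta> \<bullet> x \<noteq> 0" using y[of \<beta>] c by (simp add: x_def)
  qed
qed

lemma smooth_on_potential:
  assumes "open U" "smooth_on R' U" "\<And>\<beta> x. \<beta> \<in> H \<Longrightarrow> x \<in> U \<Longrightarrow> \<beta> \<bullet> x \<noteq> 0"
  shows "smooth_on (potential H C R') U"
proof -
  interpret open_domain U by unfold_locales fact
  have "smooth_on (\<lambda>x. C \<beta> * (1 / of_real ((\<beta> \<bullet> x)\<^sup>2))) U" if "\<beta> \<in> H" for \<beta>
    using that assms(3) by (intro smooth_cmult smooth_on_subset[OF smooth_on_inverse_square]) auto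
  then have "smooth_on (\<lambda>x. (\<Sum>\<beta>\<in>H. C \<beta> * (1 / of_real ((\<beta> \<bullet> x)\<^sup>2))) + R' x) U"
    by (intro smooth_add smooth_sum assms(2))
  then show ?thesis by (simp add: potential_def[abs_def])
qed

theorem theorem1p1:
  fixes H :: "(real ^ 'n) set" and C :: "real ^ 'n \<Rightarrow> complex" and R' :: "real ^ 'n \<Rightarrow> complex"
    and r :: real and D :: "(real ^ 'n) set"
    and m :: nat and a :: "('n \<Rightarrow> nat) \<Rightarrow> real ^ 'n \<Rightarrow> complex" and \<alpha> :: "real ^ 'n"
  assumes "finite H"
    and "\<And>\<beta>. \<beta> \<in> H \<Longrightarrow> \<beta> \<noteq> 0"
    and "\<And>\<beta> \<gamma>. \<beta> \<in> H \<Longrightarrow> \<gamma> \<in> H \<Longrightarrow> \<beta> \<noteq> \<gamma> \<Longrightarrow> \<not> (\<exists>c. \<gamma> = c *\<^sub>R \<beta>)"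
    and "\<And>\<beta>. \<beta> \<in> H \<Longrightarrow> C \<beta> \<noteq> 0"
    and "r > 0"
    and "real_analytic_on R' (ball 0 r)"
    and "D = ball 0 r - (\<Union>\<beta>\<in>H. hyperplane \<beta>)"
    and "analytic_coeffs_on D m a"
    and "has_order_on D m a"
    and "constant_principal_symbol_on D m a"
    and "commute_on D (schroedinger (potential H C R')) (diff_op m a)"
    and "\<alpha> \<in> H"
    and "\<And>k :: int. C \<alpha> \<noteq> of_int (k * (k + 1)) * of_real (\<alpha> \<bullet> \<alpha>)"
  shows "\<forall>x\<in>D. \<forall>\<xi>. principal_symbol m a x (reflection \<alpha> \<xi>) = principal_symbol m a x \<xi>"
proof (intro ballI allI)
  fix x \<xi> assume x: "x \<in> D"
  have \<alpha>: "\<alpha> \<noteq> 0" using assms(2,12) by blast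
  have D: "y \<in> D \<longleftrightarrow> y \<in> ball 0 r \<and> (\<forall>\<beta>\<in>H. \<beta> \<bullet> y \<noteq> 0)" for y
    by (auto simp: assms(7) hyperplane_def)
  have "D = ball 0 r \<inter> (\<Inter>\<beta>\<in>H. {y. \<beta> \<bullet> y \<noteq> 0})" using D by auto
  then have open_D: "open D"
    using assms(1) by (auto intro!: open_Int open_INT open_inner_nonzero)
  define B where "B = H - {\<alpha>}"
  have B: "finite B" using assms(1) by (simp add: B_def)
  have B_not_parallel: "\<not> (\<exists>c. \<beta> = c *\<^sub>R \<alpha>)" if "\<beta> \<in> B" for \<beta>
    by (rule assms(3)[OF assms(12)]) (use that in \<open>auto simp: B_def\<close>)
  \<comment> \<open>Near a wall point off all other hyperplanes the remaining singular terms are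
    smooth across the wall.\<close>
  obtain x\<^sub>0 where x\<^sub>0: "\<alpha> \<bullet> x\<^sub>0 = 0" "norm x\<^sub>0 < r" "\<And>\<beta>. \<beta> \<in> B \<Longrightarrow> \<beta> \<bullet> x\<^sub>0 \<noteq> 0"
    using ex_generic_wall_point[OF B \<alpha> B_not_parallel assms(5)] by blast
  have "open (ball 0 r \<inter> (\<Inter>\<beta>\<in>B. {y. \<beta> \<bullet> y \<noteq> 0}))"
    using B by (intro open_Int open_INT open_ball ballI open_inner_nonzero)
  moreover have "x\<^sub>0 \<in> ball 0 r \<inter> (\<Inter>\<beta>\<in>B. {y. \<beta> \<bullet> y \<noteq> 0})" using x\<^sub>0 by auto
  ultimately obtain d where d: "d > 0" and sub: "ball x\<^sub>0 d \<subseteq> ball 0 r \<inter> (\<Inter>\<beta>\<in>B. {y. \<beta> \<bullet> y \<noteq> 0})"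
    using openE by blast
  have ball: "y \<in> ball 0 r" "\<And>\<beta>. \<beta> \<in> B \<Longrightarrow> \<beta> \<bullet> y \<noteq> 0" if "y \<in> ball x\<^sub>0 d" for y
    using sub that by auto
  interpret wall \<alpha> x\<^sub>0 d by unfold_locales (use \<alpha> x\<^sub>0 d in auto)
  have \<Omega>_D: "\<Omega> \<subseteq> D"
  proof
    fix y assume "y \<in> \<Omega>"
    then have "y \<in> ball x\<^sub>0 d" "\<alpha> \<bullet> y \<noteq> 0" by (auto simp: \<Omega>_def)
    then show "y \<in> D" unfolding D using ball[of y] by (auto simp: B_def)
  qed
  have R'_smooth: "smooth_on R' (ball 0 r)"
    by (rule real_analytic_on_imp_smooth_on) fact
  have a_analytic: "real_analytic_on (a q) D" if "mi_size q \<le> m" for q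
    using assms(8) that by (simp add: analytic_coeffs_on_def)
  have const: "a q y = a q x" if "mi_size q = m" "y \<in> D" for q y
    using assms(10) that x by (auto simp: constant_principal_symbol_on_def constant_on_def)
  have "smooth_on (potential B C R') (ball x\<^sub>0 d)"
    using ball by (intro smooth_on_potential smooth_on_subset[OF R'_smooth]) auto
  \<comment> \<open>Order 0 is above \<open>-2 + 1/2\<close>, so everything except the pole
    belonging to \<alpha> counts as remainder.\<close>
  then have "T (-2) 0 (potential B C R')"
    by (intro T_error E_mono[OF E_ball]) auto
  with T_cmult[OF T_wpow[of "-2"], of "C \<alpha>"]
  have "T (-2) (C \<alpha> * 1 + 0) (\<lambda>y. C \<alpha> * wpow \<alpha> (-2) y + potential B C R' y)"
    by (intro T_add)
  moreover have "potential H C R' y = C \<alpha> * wpow \<alpha> (-2) y + potential B C R' y" if "y \<in> \<Omega>" for y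
    using that assms(1,12)
    by (simp add: potential_def B_def sum.remove[of H \<alpha>] wpow_def \<Omega>_def powr_minus powr_numeral field_simps)
  ultimately have T_R: "T (-2) (C \<alpha>) (potential H C R')"
    by (subst T_cong) auto
  \<comment> \<open>The top coefficients are the same constants on all of \<open>D\<close>, so their
    values at the given \<open>x\<close> may be used near the wall even if \<open>x\<close> lies in
    another component.\<close>
  interpret commuting_wall \<alpha> x\<^sub>0 d D "potential H C R'" m a "\<lambda>q. a q x" "C \<alpha>"
  proof unfold_locales
    show "D \<subseteq> {y. \<alpha> \<bullet> y \<noteq> 0}" using D assms(12) by auto
    show "smooth_on (potential H C R') D"
      using D open_D by (intro smooth_on_potential smooth_on_subset[OF R'_smooth]) auto
    show "smooth_on (a q) D" if "mi_size q \<le> m" for q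
      by (rule real_analytic_on_imp_smooth_on[OF a_analytic[OF that]])
    show "derivs_commute_on (a q) \<Omega>" if "mi_size q \<le> m" for q
      by (rule derivs_commute_on_subset[OF real_analytic_on_derivs_commute[OF open_D a_analytic[OF that]] \<Omega>_D])
    show "a q y = a q x" if "mi_size q = m" "y \<in> \<Omega>" for q y
      using const that \<Omega>_D by blast
  qed (fact open_D \<Omega>_D assms(11) T_R)+
  \<comment> \<open>In the splitting into a multiple of \<alpha> and a vector tangential to the
    wall, the reflection changes only the sign of \<sigma>.\<close>
  define \<sigma> where "\<sigma> = (\<alpha> \<bullet> \<xi>) / (\<alpha> \<bullet> \<alpha>)"
  define \<eta> where "\<eta> = \<xi> - \<sigma> *\<^sub>R \<alpha>"
  have \<eta>: "\<alpha> \<bullet> \<eta> = 0" using \<alpha> by (simp add: \<eta>_def \<sigma>_def inner_diff_right)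
  have "\<xi> = \<eta> + \<sigma> *\<^sub>R \<alpha>" by (simp add: \<eta>_def)
  moreover have "reflection \<alpha> \<xi> = \<eta> - \<sigma> *\<^sub>R \<alpha>"
  proof -
    have "2 * (\<alpha> \<bullet> \<xi>) / (\<alpha> \<bullet> \<alpha>) = \<sigma> + \<sigma>" by (simp add: \<sigma>_def)
    then show ?thesis by (simp only: reflection_def \<eta>_def scaleR_add_left diff_diff_eq)
  qed
  ultimately show "principal_symbol m a x (reflection \<alpha> \<xi>) = principal_symbol m a x \<xi>"
    using symbol_even[OF \<eta> assms(13), of \<sigma>] by (simp add: principal_symbol_def)
qed

end
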